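(* Let $n\in\mathbb{N}$, let $X_1,\ldots,X_n$ be real-valued random variables that are pQAI, with distributions $F_1,\ldots,F_n\in\mathcal{D}$ respectively, and let $\Theta_1,\ldots,\Theta_n$ be non-negative random variables, non-degenerate at zero. Suppose that: (i) there exist functions $b_i:[0,\infty)\to(0,\infty)$, $i=1,\ldots,n$, such that $b_i(x)\to\infty$ and $b_i(x)/x\to 0$ as $x\to\infty$, and, for all $1\le i\ne j\le n$, $$\mathbf{P}[\Theta_i>b_i(x_i)]=o\big(\mathbf{P}[\Theta_iX_i>x_i,\ \Theta_jX_j>x_j]\big)\quad\text{as } x_i\wedge x_j\to\infty;$$ (ii) for each $i=1,\ldots,n$ there exists a function $h_i:[0,\infty)\to(0,\infty)$ such that $$\mathbf{P}[X_i>x\mid\Theta_i=\theta]\sim h_i(\theta)\,\mathbf{P}[X_i>x]\quad\text{as }x\to\infty,\ \text{uniformly for }\theta\in s_{\Theta_i};$$ (iii) there exist measurable functions $g_{ij}:[0,\infty)^2\to(0,\infty)$, $1\le i\ne j\le n$, and constants $0<L\le U<\infty$ such that, for all $1\le i\neq j\le n$, as $x_i\wedge x_j\to\infty$, uniformly for $(\theta_i,\theta_j)\in s_{\Theta_i}\times s_{\Theta_j}$, $$\mathbf{P}[|X_i|>x_i,\ X_j>x_j\mid\Theta_i=\theta_i,\Theta_j=\theta_j]\sim g_{ij}(\theta_i,\theta_j)\,\mathbf{P}[|X_i|>x_i,\ X_j>x_j]$$ and $$L\,g_{ij}(\theta_i,\theta_j)\mathbf{P}[X_i>x_i,X_j>x_j]\lesssim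 \mathbf{P}[X_i>x_i,X_j>x_j\mid\Theta_i=\theta_i,\Theta_j=\theta_j]\lesssim U\,g_{ij}(\theta_i,\theta_j)\mathbf{P}[X_i>x_i,X_j>x_j].$$ Let $\varphi:\mathbb{R}\to[0,\infty)$ be a function such that: (1) $\varphi$ is ultimately non-decreasing; (2) $\varphi$ is ultimately sub-homogeneous, i.e. there is a constant $C>0$ with $\varphi(2x)\le C\varphi(x)$ for all sufficiently large $x$; (3) $\varphi$ is ultimately differentiable; (4* ) for every $1\le i\le n$, $\mathbf{E}[\varphi(\Theta_iX_i)\mathbf{1}_{\{\Theta_iX_i>x\}}]<\infty$ for all sufficiently large $x$. Write $S_n^{\Theta}=\sum_{i=1}^n\Theta_iX_i$. Then, as $x\to\infty$, $$\sum_{i=1}^nL_{F_i}\,\mathbf{E}\big[\varphi(\Theta_iX_i)\mathbf{1}_{\{\Theta_iX_i>x\}}\big]\lesssim\mathbf{E}\big[\varphi(S_n^{\Theta})\mathbf{1}_{\{S_n^{\Theta}>x\}}\big]\lesssim\sum_{i=1}^n\frac1{L_{F_i}}\,\mathbf{E}\big[\varphi(\Theta_iX_i)\mathbf{1}_{\{\Theta_iX_i>x\}}\big].$$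
   Context: For a distribution $F$, $\overline F(x)=1-F(x)$; throughout $\overline F_i(x)>0$ for all $x\ge0$ and all $i$. "Non-degenerate at zero" means not almost surely equal to $0$. $x\wedge y=\min\{x,y\}$, $x\vee y=\max\{x,y\}$, $x^+=\max\{x,0\}$, $x^-=-\min\{x,0\}$. A property holds "ultimately" if it holds for all sufficiently large arguments. $f=o(g)$ means $f/g\to0$; $f\sim g$ means $f/g\to1$; $f\lesssim g$ means $\limsup f/g\le1$; $f\gtrsim g$ means $\liminf f/g\ge1$. Uniformity of $\sim$ over $\theta$ means that the supremum over $\theta$ of $|f/g-1|$ tends to $0$; uniformity of $\lesssim$ means $\limsup$ of the supremum over $\theta$ of the ratio $f/g$ is $\le1$. Support: $s_{\Theta_i}=\{\theta\in\mathbb{R}:\mathbf{P}(\Theta_i\in[\theta-\delta,\theta+\delta])>0\text{ for any }\delta>0\}$. For an event $A$, $\mathbf{P}[A\mid\Theta_i=\theta_i,\Theta_j=\theta_j]$ is defined as $$\lim_{\delta\downarrow0}\frac{\mathbf{P}[A,\ \Theta_i\in[\theta_i-\delta,\theta_i+\delta],\ \Theta_j\in[\theta_j-\delta,\theta_j+\delta]]}{\mathbf{P}[\Theta_i\in[\theta_i-\delta,\theta_i+\delta],\ \Theta_j\in[\theta_j-\delta,\theta_j+\delta]]},$$ and $\mathbf{P}[A\mid\Theta_i=\theta]$ is defined analogously with a single weight. Class $\mathcal{D}$ (dominatedly varying): $F\in\mathcal{D}$ if $\limsup_{x\to\infty}\overline F(bx)/\overline F(x)<\infty$ for any (equivalently,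 some) $b\in(0,1)$. The $L$-index of $F$ is $L_F=\lim_{v\downarrow1}\liminf_{x\to\infty}\overline F(vx)/\overline F(x)\in[0,1]$; it is positive if and only if $F\in\mathcal{D}$. Real-valued random variables $Y_1,\ldots,Y_n$ are pQAI (pairwise quasi-asymptotically independent) if for all $i\neq j$, $$\lim_{x\to\infty}\frac{\mathbf{P}[Y_i^+>x,\,Y_j^+>x]}{\mathbf{P}[Y_i>x]+\mathbf{P}[Y_j>x]}=\lim_{x\to\infty}\frac{\mathbf{P}[Y_i^->x,\,Y_j>x]}{\mathbf{P}[Y_i>x]+\mathbf{P}[Y_j>x]}=0.$$ *)

theory Defs
  imports "HOL-Probability.Probability" "HOL-Library.Landau_Symbols"
begin

definition survival :: "(real \<Rightarrow> real) \<Rightarrow> real \<Rightarrow> real" where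
  "survival F x = 1 - F x"

text \<open>
  Quotients that are compared with a limsup are formed in \<^typ>\<open>ennreal\<close>, where a positive
  number divided by zero is \<open>\<infinity>\<close> (in \<^typ>\<open>real\<close> it would be zero, making such bounds
  vacuously true) and zero divided by zero is zero.
\<close>

definition asym_le :: "'x filter \<Rightarrow> ('x \<Rightarrow> ennreal) \<Rightarrow> ('x \<Rightarrow> ennreal) \<Rightarrow> bool" where
  "asym_le \<F> f g \<longleftrightarrow> Limsup \<F> (\<lambda>x. f x / g x) \<le> 1"

definition unif_asym_le ::
    "'t set \<Rightarrow> 'x filter \<Rightarrow> ('x \<Rightarrow> 't \<Rightarrow> real) \<Rightarrow> ('x \<Rightarrow> 't \<Rightarrow> real) \<Rightarrow> bool" where
  "unif_asym_le S \<F> f g \<longleftrightarrow>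
     Limsup \<F> (\<lambda>x. SUP \<theta>\<in>S. ennreal (f x \<theta>) / ennreal (g x \<theta>)) \<le> 1"

definition unif_asym_equiv ::
    "'t set \<Rightarrow> 'x filter \<Rightarrow> ('x \<Rightarrow> 't \<Rightarrow> real) \<Rightarrow> ('x \<Rightarrow> 't \<Rightarrow> real) \<Rightarrow> bool" where
  "unif_asym_equiv S \<F> f g \<longleftrightarrow> uniform_limit S (\<lambda>x \<theta>. f x \<theta> / g x \<theta>) (\<lambda>_. 1) \<F>"

definition min_at_top :: "(real \<times> real) filter" where
  "min_at_top = filtercomap (\<lambda>(x, y). min x y) at_top"

definition dominatedly_varying :: "(real \<Rightarrow> real) \<Rightarrow> bool" where
  "dominatedly_varying F \<longleftrightarrow>
     (\<forall>b\<in>{0<..<1}. Limsup at_top (\<lambda>x. ennreal (survival F (b * x) / survival F x)) < \<infinity>)"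

definition L_index :: "(real \<Rightarrow> real) \<Rightarrow> ennreal" where
  "L_index F =
     Lim (at_right 1) (\<lambda>v. Liminf at_top (\<lambda>x. ennreal (survival F (v * x) / survival F x)))"

definition pQAI :: "'a measure \<Rightarrow> 'i set \<Rightarrow> ('i \<Rightarrow> 'a \<Rightarrow> real) \<Rightarrow> bool" where
  "pQAI M I Y \<longleftrightarrow>
     (\<forall>i\<in>I. \<forall>j\<in>I. i \<noteq> j \<longrightarrow>
        ((\<lambda>x. \<P>(\<omega> in M. max (Y i \<omega>) 0 > x \<and> max (Y j \<omega>) 0 > x)
              / (\<P>(\<omega> in M. Y i \<omega> > x) + \<P>(\<omega> in M. Y j \<omega> > x))) \<longlongrightarrow> 0) at_top \<and>
        ((\<lambda>x. \<P>(\<omega> in M. - min (Y i \<omega>) 0 > x \<and> Y j \<omega> > x)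
              / (\<P>(\<omega> in M. Y i \<omega> > x) + \<P>(\<omega> in M. Y j \<omega> > x))) \<longlongrightarrow> 0) at_top)"

definition rv_support :: "'a measure \<Rightarrow> ('a \<Rightarrow> real) \<Rightarrow> real set" where
  "rv_support M T = {\<theta>. \<forall>\<delta>>0. \<P>(\<omega> in M. T \<omega> \<in> {\<theta> - \<delta>..\<theta> + \<delta>}) > 0}"

text \<open>
  Conditional probabilities given a null event that is approximated by events \<open>E \<delta>\<close> as
  \<open>\<delta>\<close> decreases to zero.  The limit need not exist, and \<^const>\<open>Lim\<close> is unspecified then,
  so existence is a separate predicate.
\<close>

definition cond_ratio ::
    "'a measure \<Rightarrow> ('a \<Rightarrow> bool) \<Rightarrow> (real \<Rightarrow> 'a \<Rightarrow> bool) \<Rightarrow> real \<Rightarrow> real" where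
  "cond_ratio M A E \<delta> = \<P>(\<omega> in M. A \<omega> \<and> E \<delta> \<omega>) / \<P>(\<omega> in M. E \<delta> \<omega>)"

definition has_cond_prob :: "'a measure \<Rightarrow> ('a \<Rightarrow> bool) \<Rightarrow> (real \<Rightarrow> 'a \<Rightarrow> bool) \<Rightarrow> bool" where
  "has_cond_prob M A E \<longleftrightarrow> (\<exists>p. (cond_ratio M A E \<longlongrightarrow> p) (at_right 0))"

definition cond_prob_at :: "'a measure \<Rightarrow> ('a \<Rightarrow> bool) \<Rightarrow> (real \<Rightarrow> 'a \<Rightarrow> bool) \<Rightarrow> real" where
  "cond_prob_at M A E = Lim (at_right 0) (cond_ratio M A E)"

definition near1 :: "('a \<Rightarrow> real) \<Rightarrow> real \<Rightarrow> real \<Rightarrow> 'a \<Rightarrow> bool" where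
  "near1 T t \<delta> \<omega> \<longleftrightarrow> T \<omega> \<in> {t - \<delta>..t + \<delta>}"

definition near2 ::
    "('a \<Rightarrow> real) \<Rightarrow> ('a \<Rightarrow> real) \<Rightarrow> real \<times> real \<Rightarrow> real \<Rightarrow> 'a \<Rightarrow> bool" where
  "near2 T T' p \<delta> \<omega> \<longleftrightarrow> near1 T (fst p) \<delta> \<omega> \<and> near1 T' (snd p) \<delta> \<omega>"

text \<open>The expectation of \<open>\<phi>(Y)\<close> restricted to the event \<open>Y > x\<close>, with values in \<open>[0, \<infinity>]\<close>.\<close>

definition tail_expectation ::
    "'a measure \<Rightarrow> (real \<Rightarrow> real) \<Rightarrow> ('a \<Rightarrow> real) \<Rightarrow> real \<Rightarrow> ennreal" where
  "tail_expectation M \<phi> Y x = (\<integral>\<^sup>+\<omega>. ennreal (\<phi> (Y \<omega>)) * indicator {x<..} (Y \<omega>) \<partial>M)"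

end

theory Submission
  imports Defs
begin

text \<open>
  Write \<open>W\<^sub>i = \<Theta>\<^sub>i X\<^sub>i\<close>.  For two or more summands the weights are in fact bounded.  In condition (i) the two
  thresholds tend to infinity independently of each other; with the first one fixed and the second
  one sent to infinity, the joint tail tends to zero, so \<open>P[\<Theta>\<^sub>i > b\<^sub>i(x)] = 0\<close> for some \<open>x\<close>
  (\<open>weight_bounded\<close>).  Pairwise quasi-asymptotic independence then passes from the \<open>X\<^sub>i\<close> to the \<open>W\<^sub>i\<close>:
  with \<open>0 \<le> \<Theta>\<^sub>i, \<Theta>\<^sub>j \<le> K\<close> the event that \<open>\<bar>W\<^sub>i\<bar>\<close> and \<open>W\<^sub>j\<close> exceed \<open>kx\<close> forces \<open>\<bar>X\<^sub>i\<bar>\<close> and \<open>X\<^sub>j\<close> above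
  \<open>kx / K\<close>, dominated variation brings the threshold back to \<open>x\<close>, and the tail of \<open>W\<^sub>i\<close> is at
  least a constant times that of \<open>X\<^sub>i\<close> (\<open>tail_of_product_lower_bound\<close>, \<open>joint_tail_of_products\<close>).

  The sharp constants \<open>L\<^bsub>F\<^sub>i\<^esub>\<close> require that \<open>P[W\<^sub>i > wx] / P[W\<^sub>i > x]\<close> is, for \<open>w\<close> near 1 and large \<open>x\<close>, not
  much below \<open>L\<^bsub>F\<^sub>i\<^esub>\<close> (\<open>tail_ratio_of_product\<close>).  By condition (ii), near a point \<open>t > 0\<close> the probabilities of
  \<open>X\<^sub>i > vx / t\<close> and \<open>X\<^sub>i > x / t\<close>, restricted to \<open>\<Theta>\<^sub>i \<in> [t - d, t + d]\<close>, compare like the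
  unconditional tails, because the factor \<open>h\<^sub>i(t)\<close> cancels.  These local comparisons are globalised by
  a differentiation theorem without loss of constants: if two finite measures on the line satisfy
  \<open>N2 [t - d, t + d] \<le> N1 [t - d, t + d]\<close> for all small \<open>d\<close>, at every \<open>t\<close> of a Borel set, then \<open>N2 \<le> N1\<close>
  on that set (\<open>measure_le_of_symmetric_intervals\<close>).

  A single-big-jump decomposition of the sum gives the theorem for tail probabilities
  (\<open>tail_of_sum\<close>).  Since \<open>\<phi>\<close> is eventually non-decreasing, \<open>\<phi>(u) 1{u > x}\<close> is a mixture of
  indicators of half-lines contained in \<open>(x, \<infinity>)\<close>, so an inequality between tails that holds at all levels
  beyond \<open>x\<close> carries over to the truncated expectations (\<open>tail_expectation_mono\<close>).
\<close>

section \<open>Comparison of measures on the line by symmetric intervals\<close>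

text \<open>
  A covering estimate.  Let \<open>K\<close> be bounded and let every subset of \<open>K\<close> have at most as much
  \<open>N1\<close>-measure as \<open>N2\<close>-measure, while the intervals of radius \<open>d\<close> about the points of \<open>K\<close> compare the
  other way.  The line is cut into cells of length \<open>d\<close>, and in each cell that meets \<open>K\<close> a point of
  \<open>K\<close> is chosen.  Its interval contains the cell and meets at most the two neighbouring
  cells, whence the overlap 3, which only affects the part outside \<open>K\<close>.
\<close>

lemma measure_le_of_cover:
  fixes N1 N2 :: "real measure"
  assumes fin: "finite_measure N1" "finite_measure N2"
    and sets: "sets N1 = sets borel" "sets N2 = sets borel"
    and K: "K \<in> sets borel" "bounded K" and U: "U \<in> sets borel"
    and d: "d > 0"
    and nbhd: "\<And>p. p \<in> K \<Longrightarrow> {p - d..p + d} \<subseteq> U"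
    and loc: "\<And>p. p \<in> K \<Longrightarrow> measure N2 {p - d..p + d} \<le> measure N1 {p - d..p + d}"
    and hahn: "\<And>A. A \<in> sets borel \<Longrightarrow> A \<subseteq> K \<Longrightarrow> measure N1 A \<le> measure N2 A"
  shows "measure N2 K \<le> measure N1 K + 3 * measure N1 (U - K)"
proof -
  interpret N1: finite_measure N1 by fact
  interpret N2: finite_measure N2 by fact
  note [measurable_cong] = sets
  have [measurable]: "K \<in> sets borel" "U \<in> sets borel" by fact+
  \<comment> \<open>\<open>c x\<close> is the index of the cell that contains \<open>x\<close>, \<open>J\<close> the set of cells that meet \<open>K\<close>\<close>
  define c where "c x = \<lfloor>x / d\<rfloor>" for x
  define C where "C z = {x. c x = z}" for z
  have [measurable]: "C z \<in> sets borel" for z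
    unfolding C_def c_def by measurable
  define J where "J = c ` K"
  obtain B where B: "\<And>x. x \<in> K \<Longrightarrow> \<bar>x\<bar> \<le> B"
    using K(2) by (auto simp: bounded_iff)
  have "c x \<in> {c (-B)..c B}" if "x \<in> K" for x
    unfolding c_def atLeastAtMost_iff using B[OF that] d
    by (intro conjI floor_mono divide_right_mono) auto
  then have "J \<subseteq> {c (-B)..c B}" unfolding J_def by blast
  then have J: "finite J" using finite_subset by blast
  define p where "p z = (SOME x. x \<in> K \<and> c x = z)" for z
  have p: "p z \<in> K \<and> c (p z) = z" if "z \<in> J" for z
    unfolding p_def by (rule someI_ex) (use that in \<open>auto simp: J_def\<close>)
  define I where "I z = {p z - d..p z + d}" for z
  have [measurable]: "I z \<in> sets borel" for z unfolding I_def by simp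
  have cellI: "x \<in> I z" if "z \<in> J" "x \<in> C z" for x z
  proof -
    have "c x = c (p z)" using p[OF that(1)] that(2) by (simp add: C_def)
    then have "\<bar>x / d - p z / d\<bar> < 1" unfolding c_def by linarith
    then have "\<bar>x - p z\<bar> < d" using d
      by (simp add: diff_divide_distrib[symmetric] abs_divide)
    then show ?thesis by (auto simp: I_def)
  qed
  have Icell: "c x \<in> {z - 1, z, z + 1}" if "z \<in> J" "x \<in> I z" for x z
  proof -
    have "\<bar>x - p z\<bar> \<le> d" using that(2) by (auto simp: I_def)
    then have "\<bar>x / d - p z / d\<bar> \<le> 1" using d
      by (simp add: diff_divide_distrib[symmetric] abs_divide)
    moreover have "c (p z) = z" using p[OF that(1)] by simp
    ultimately have "\<bar>c x - z\<bar> \<le> 1" unfolding c_def by linarith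
    then show ?thesis by auto
  qed
  have disj: "disjoint_family_on (\<lambda>z. A \<inter> C (z + s)) J" for A s
    by (auto simp: disjoint_family_on_def C_def)
  have part: "(\<Sum>z\<in>J. measure N (A \<inter> C (z + s))) \<le> measure N A"
    if "finite_measure N" "sets N = sets borel" "A \<in> sets borel" for N A s
  proof -
    interpret N: finite_measure N by fact
    note [measurable_cong] = that(2)
    have [measurable]: "A \<in> sets borel" by fact
    have "(\<Sum>z\<in>J. measure N (A \<inter> C (z + s))) = measure N (\<Union>z\<in>J. A \<inter> C (z + s))"
      by (rule N.finite_measure_finite_Union[symmetric])
        (use disj in \<open>auto simp: J that intro!: sets.Int\<close>)
    also have "\<dots> \<le> measure N A"
      by (intro N.finite_measure_mono) (auto simp: that)
    finally show ?thesis .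
  qed
  have partK: "(\<Sum>z\<in>J. measure N (K \<inter> C z)) = measure N K"
    if "finite_measure N" "sets N = sets borel" for N
  proof -
    interpret N: finite_measure N by fact
    have "(\<Sum>z\<in>J. measure N (K \<inter> C z)) = measure N (\<Union>z\<in>J. K \<inter> C z)"
      by (rule N.finite_measure_finite_Union[symmetric])
        (use disj[of K 0] in \<open>auto simp: J that intro!: sets.Int\<close>)
    also have "(\<Union>z\<in>J. K \<inter> C z) = K"
      by (auto simp: J_def C_def)
    finally show ?thesis .
  qed
  have cell: "measure N2 (K \<inter> C z) \<le> measure N1 (K \<inter> C z) +
      (\<Sum>s\<in>{-1,0,1}. measure N1 ((U - K) \<inter> C (z + s)))" if z: "z \<in> J" for z
  proof -
    have split: "measure N (I z) =
        measure N (K \<inter> C z) + measure N (I z \<inter> K - C z) + measure N (I z - K)"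
      if "finite_measure N" "sets N = sets borel" for N
    proof -
      interpret N: finite_measure N by fact
      note [measurable_cong] = that(2)
      have "measure N (I z) = measure N (I z \<inter> K) + measure N (I z - K)"
        by (subst N.finite_measure_Union[symmetric])
          (auto simp: that intro!: arg_cong[where f="measure N"])
      also have "measure N (I z \<inter> K) = measure N (K \<inter> C z) + measure N (I z \<inter> K - C z)"
        by (subst N.finite_measure_Union[symmetric])
          (use cellI[OF z] in \<open>auto simp: that intro!: arg_cong[where f="measure N"]\<close>)
      finally show ?thesis .
    qed
    have "measure N1 (I z - K) \<le> measure N1 (\<Union>s\<in>{-1,0,1}. (U - K) \<inter> C (z + s))"
    proof (rule N1.finite_measure_mono)
      show "I z - K \<subseteq> (\<Union>s\<in>{-1,0,1}. (U - K) \<inter> C (z + s))"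
      proof
        fix x assume x: "x \<in> I z - K"
        then have "x \<in> U - K" using nbhd[of "p z"] p[OF z] by (auto simp: I_def)
        moreover have "c x \<in> {z - 1, z, z + 1}" using Icell[OF z] x by auto
        ultimately show "x \<in> (\<Union>s\<in>{-1,0,1}. (U - K) \<inter> C (z + s))"
          by (auto simp: C_def)
      qed
    qed (auto simp: sets)
    also have "\<dots> \<le> (\<Sum>s\<in>{-1,0,1}. measure N1 ((U - K) \<inter> C (z + s)))"
      by (rule N1.finite_measure_subadditive_finite) (auto simp: sets intro!: sets.Int)
    finally have "measure N1 (I z - K) \<le> (\<Sum>s\<in>{-1,0,1}. measure N1 ((U - K) \<inter> C (z + s)))" .
    moreover have "measure N1 (I z \<inter> K - C z) \<le> measure N2 (I z \<inter> K - C z)"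
      by (rule hahn) auto
    moreover have "measure N2 (I z) \<le> measure N1 (I z)"
      unfolding I_def using loc p[OF z] by blast
    moreover have "measure N2 (I z - K) \<ge> 0" by simp
    ultimately show ?thesis
      using split[OF fin(1) sets(1)] split[OF fin(2) sets(2)] by linarith
  qed
  have "measure N2 K = (\<Sum>z\<in>J. measure N2 (K \<inter> C z))"
    by (rule partK[OF fin(2) sets(2), symmetric])
  also have "\<dots> \<le> (\<Sum>z\<in>J. measure N1 (K \<inter> C z) +
      (\<Sum>s\<in>{-1,0,1}. measure N1 ((U - K) \<inter> C (z + s))))"
    by (rule sum_mono) (rule cell)
  also have "\<dots> = measure N1 K + (\<Sum>s\<in>{-1,0,1}. \<Sum>z\<in>J. measure N1 ((U - K) \<inter> C (z + s)))"
    unfolding sum.distrib partK[OF fin(1) sets(1)] by (subst sum.swap) simp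
  also have "\<dots> \<le> measure N1 K + (\<Sum>s\<in>{-1,0,1::int}. measure N1 (U - K))"
    by (intro add_left_mono sum_mono part fin sets) auto
  also have "\<dots> = measure N1 K + 3 * measure N1 (U - K)" by simp
  finally show ?thesis .
qed

text \<open>
  On a Hahn set \<open>Y\<close> where \<open>N1 \<le> N2\<close>, a strict inequality would persist on a compact subset \<open>K\<close> of the
  points at which the hypothesis holds for all radii \<open>1 / (m + 1)\<close> with \<open>m \<ge> k\<close>.  The covering estimate
  for such a radius, with the \<open>N1\<close>-measure of a small neighbourhood of \<open>K\<close> close to that of \<open>K\<close>,
  contradicts it.  Using one radius for all centres is what makes a grid sufficient in place of a covering
  theorem of Besicovitch type.
\<close>

lemma measure_le_of_symmetric_intervals:
  fixes N1 N2 :: "real measure"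
  assumes fin: "finite_measure N1" "finite_measure N2"
    and sets: "sets N1 = sets borel" "sets N2 = sets borel"
    and S: "S \<in> sets borel"
    and loc: "\<And>t. t \<in> S \<Longrightarrow>
      \<forall>\<^sub>F d in at_right 0. measure N2 {t - d..t + d} \<le> measure N1 {t - d..t + d}"
  shows "measure N2 S \<le> measure N1 S"
proof -
  interpret N1: finite_measure N1 by fact
  interpret N2: finite_measure N2 by fact
  note [measurable_cong] = sets
  have [measurable]: "S \<in> sets borel" by fact
  obtain Y where Y: "Y \<in> sets borel" "Y \<subseteq> S"
    and Yle: "\<And>A. A \<in> sets borel \<Longrightarrow> A \<subseteq> Y \<Longrightarrow> measure N1 A \<le> measure N2 A"
    and Yge: "\<And>A. A \<in> sets borel \<Longrightarrow> A \<subseteq> S \<Longrightarrow> A \<inter> Y = {} \<Longrightarrow> measure N2 A \<le> measure N1 A"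
  proof -
    have "\<exists>Y\<in>sets N2. Y \<subseteq> S \<and> (\<forall>X\<in>sets N2. X \<subseteq> Y \<longrightarrow> N1 X \<le> N2 X) \<and>
        (\<forall>X\<in>sets N2. X \<subseteq> S \<longrightarrow> X \<inter> Y = {} \<longrightarrow> N2 X \<le> N1 X)"
      by (rule unsigned_Hahn_decomposition) (auto simp: sets)
    then show ?thesis
      using that by (auto simp: sets N1.emeasure_eq_measure N2.emeasure_eq_measure)
  qed
  have [measurable]: "Y \<in> sets borel" by fact
  have *: "measure N2 Y \<le> measure N1 Y"
  proof (rule ccontr)
    assume "\<not> measure N2 Y \<le> measure N1 Y"
    then have neg: "measure N1 Y < measure N2 Y" by simp
    define r where "r m = 1 / real (Suc m)" for m
    define E where "E k = {t\<in>Y. \<forall>m\<ge>k. measure N2 {t - r m..t + r m} \<le> measure N1 {t - r m..t + r m}}" for k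
    have meas: "(\<lambda>t. measure N {t - r m..t + r m}) \<in> borel_measurable borel"
      if "finite_measure N" "sets N = sets borel" for N :: "real measure" and m
    proof -
      interpret N: finite_measure N by fact
      have "closed {x::real \<times> real. \<bar>snd x - fst x\<bar> \<le> r m}"
        by (intro closed_Collect_le continuous_intros)
      moreover have "sets (borel \<Otimes>\<^sub>M N) = sets (borel :: (real \<times> real) measure)"
        using sets_pair_measure_cong[OF refl that(2), of "borel :: real measure"] by (simp only: borel_prod)
      ultimately have "{x::real \<times> real. \<bar>snd x - fst x\<bar> \<le> r m} \<in> sets (borel \<Otimes>\<^sub>M N)"
        by (simp only: borel_closed)
      then have "(\<lambda>t. emeasure N (Pair t -` {x::real \<times> real. \<bar>snd x - fst x\<bar> \<le> r m})) \<in> borel_measurable borel"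
        by (rule N.measurable_emeasure_Pair)
      moreover have "Pair t -` {x::real \<times> real. \<bar>snd x - fst x\<bar> \<le> r m} = {t - r m..t + r m}" for t
        by (auto simp: abs_le_iff)
      ultimately show ?thesis by (simp add: measure_def)
    qed
    have Eb [measurable]: "E k \<in> sets borel" for k
    proof -
      note [measurable] = meas[OF fin(1) sets(1)] meas[OF fin(2) sets(2)]
      have "Measurable.pred borel (\<lambda>t. t \<in> Y \<and> (\<forall>m\<in>{k..}. measure N2 {t - r m..t + r m} \<le> measure N1 {t - r m..t + r m}))"
        by measurable
      then show ?thesis by (simp add: pred_def E_def)
    qed
    have rlim: "filterlim r (at_right 0) sequentially"
      unfolding r_def filterlim_at
      using LIMSEQ_inverse_real_of_nat by (auto simp: inverse_eq_divide)
    have "(\<Union>k. E k) = Y"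
    proof (intro equalityI subsetI)
      fix t assume "t \<in> Y"
      then have "\<forall>\<^sub>F m in sequentially. measure N2 {t - r m..t + r m} \<le> measure N1 {t - r m..t + r m}"
        using eventually_compose_filterlim[OF loc rlim, of t] Y by auto
      then show "t \<in> (\<Union>k. E k)" using \<open>t \<in> Y\<close> by (auto simp: E_def eventually_sequentially)
    qed (auto simp: E_def)
    moreover have "incseq E" by (auto simp: E_def incseq_def)
    ultimately have "(\<lambda>k. measure N2 (E k)) \<longlonglongrightarrow> measure N2 Y"
      using N2.finite_Lim_measure_incseq[of E] Eb by (auto simp: sets image_subset_iff)
    from order_tendstoD(1)[OF this neg] obtain k where k: "measure N2 (E k) > measure N1 Y"
      by (auto simp: eventually_sequentially)
    have "emeasure N2 (E k) = (SUP K\<in>{K. K \<subseteq> E k \<and> compact K}. emeasure N2 K)"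
      by (rule inner_regular) (auto simp: sets)
    moreover have "ennreal (measure N1 Y) < emeasure N2 (E k)"
      using k by (simp add: N2.emeasure_eq_measure ennreal_less_iff)
    ultimately obtain K where K: "K \<subseteq> E k" "compact K" "measure N2 K > measure N1 Y"
      by (auto simp: less_SUP_iff N2.emeasure_eq_measure ennreal_less_iff)
    have KY: "K \<subseteq> Y" using K(1) by (auto simp: E_def)
    have Kb [measurable]: "K \<in> sets borel" using K(2) by (simp add: borel_compact)
    have "K \<noteq> {}"
    proof
      assume "K = {}"
      then have "measure N1 Y < 0" using K(3) by simp
      then show False using measure_nonneg[of N1 Y] by linarith
    qed
    have K1: "measure N1 K < measure N2 K"
      using N1.finite_measure_mono[OF KY] K(3) by (simp add: sets)
    define U where "U m = {x. infdist x K \<le> r m}" for m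
    have Ub [measurable]: "U m \<in> sets borel" for m
      unfolding U_def by (intro borel_closed closed_Collect_le continuous_intros)
    have r0: "r \<longlonglongrightarrow> 0" using rlim by (simp add: filterlim_at)
    have rpos: "r m > 0" for m by (simp add: r_def)
    have "(\<Inter>m. U m) = K"
    proof (intro equalityI subsetI)
      fix x assume "x \<in> (\<Inter>m. U m)"
      then have "infdist x K \<le> r m" for m by (auto simp: U_def)
      then have "infdist x K \<le> 0" using LIMSEQ_le_const[OF r0] by auto
      then have "infdist x K = 0" using infdist_nonneg[of x K] by linarith
      then show "x \<in> K"
        using in_closed_iff_infdist_zero[of K x] compact_imp_closed[OF K(2)] \<open>K \<noteq> {}\<close> by blast
    qed (auto simp: U_def less_imp_le[OF rpos])
    moreover have "decseq U"
    proof (rule decseq_SucI)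
      fix m have "r (Suc m) \<le> r m" by (simp add: r_def frac_le)
      then show "U (Suc m) \<subseteq> U m" by (auto simp: U_def)
    qed
    ultimately have "(\<lambda>m. measure N1 (U m)) \<longlonglongrightarrow> measure N1 K"
      using N1.finite_Lim_measure_decseq[of U] Ub by (auto simp: sets image_subset_iff)
    moreover have "measure N1 K < measure N1 K + (measure N2 K - measure N1 K) / 3"
      using K1 by simp
    ultimately have "\<forall>\<^sub>F m in sequentially. measure N1 (U m) < measure N1 K + (measure N2 K - measure N1 K) / 3"
      by (rule order_tendstoD(2))
    then obtain m0 where m0: "\<And>m. m \<ge> m0 \<Longrightarrow> measure N1 (U m) < measure N1 K + (measure N2 K - measure N1 K) / 3"
      unfolding eventually_sequentially by blast
    define m where "m = max k m0"
    have m: "m \<ge> k" "measure N1 (U m) < measure N1 K + (measure N2 K - measure N1 K) / 3"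
      using m0[of m] by (simp_all add: m_def)
    have KU: "K \<subseteq> U m" by (auto simp: U_def less_imp_le[OF rpos])
    have "measure N2 K \<le> measure N1 K + 3 * measure N1 (U m - K)"
    proof (rule measure_le_of_cover[OF fin sets])
      show "bounded K" using K(2) by (rule compact_imp_bounded)
      show "{p - r m..p + r m} \<subseteq> U m" if "p \<in> K" for p
      proof
        fix x assume "x \<in> {p - r m..p + r m}"
        then have "dist x p \<le> r m" by (auto simp: dist_real_def)
        then show "x \<in> U m" using infdist_le[OF that, of x] by (simp add: U_def)
      qed
      show "measure N2 {p - r m..p + r m} \<le> measure N1 {p - r m..p + r m}" if "p \<in> K" for p
        using that K(1) m(1) by (auto simp: E_def)
      show "measure N1 A \<le> measure N2 A" if "A \<in> sets borel" "A \<subseteq> K" for A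
        using Yle that KY by blast
    qed (auto simp: rpos)
    also have "measure N1 (U m - K) = measure N1 (U m) - measure N1 K"
      using KU by (intro N1.finite_measure_Diff) (auto simp: sets)
    finally have "measure N2 K \<le> measure N1 K + 3 * (measure N1 (U m) - measure N1 K)" .
    moreover have "3 * (measure N1 (U m) - measure N1 K) < measure N2 K - measure N1 K"
      using m(2) by (simp add: less_diff_eq field_simps)
    ultimately show False by simp
  qed
  have "measure N2 S = measure N2 Y + measure N2 (S - Y)"
    by (subst N2.finite_measure_Union[symmetric])
      (use Y in \<open>auto simp: sets intro!: arg_cong[where f="measure N2"]\<close>)
  also have "\<dots> \<le> measure N1 Y + measure N1 (S - Y)"
    by (intro add_mono * Yge) auto
  also have "\<dots> = measure N1 S"
    by (subst N1.finite_measure_Union[symmetric])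
      (use Y in \<open>auto simp: sets intro!: arg_cong[where f="measure N1"]\<close>)
  finally show ?thesis .
qed

section \<open>Dominated variation and the L-index\<close>

lemma survival_eq_prob:
  assumes "prob_space M" "X \<in> borel_measurable M"
  shows "survival (cdf (distr M borel X)) x = \<P>(\<omega> in M. X \<omega> > x)"
proof -
  interpret prob_space M by fact
  have [measurable]: "X \<in> borel_measurable M" by fact
  have "\<P>(\<omega> in M. \<not> X \<omega> \<le> x) = 1 - \<P>(\<omega> in M. X \<omega> \<le> x)"
    by (rule prob_neg) measurable
  moreover have "cdf (distr M borel X) x = \<P>(\<omega> in M. X \<omega> \<le> x)"
    by (simp add: cdf_def measure_distr vimage_def Int_def conj_commute)
  ultimately show ?thesis by (simp add: survival_def not_le)
qed

lemma dominatedly_varying_bound: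
  assumes D: "dominatedly_varying F" and anti: "antimono (survival F)"
    and pos: "\<And>x. x \<ge> 0 \<Longrightarrow> survival F x > 0" and c: "c > 0"
  obtains C where "C > 0" "\<forall>\<^sub>F x in at_top. survival F (c * x) \<le> C * survival F x"
proof (cases "c < 1")
  case True
  then have "Limsup at_top (\<lambda>x. ennreal (survival F (c * x) / survival F x)) < top"
    using D c by (auto simp: dominatedly_varying_def)
  then obtain B where B: "Limsup at_top (\<lambda>x. ennreal (survival F (c * x) / survival F x)) < B" "B < top"
    using dense by blast
  obtain C where C: "B = ennreal C" "C \<ge> 0" using B(2) by (cases B) auto
  have "\<forall>\<^sub>F x in at_top. ennreal (survival F (c * x) / survival F x) < B"
    using B(1) by (rule Limsup_lessD)
  then have "\<forall>\<^sub>F x in at_top. survival F (c * x) \<le> (C + 1) * survival F x"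
    using eventually_ge_at_top[of "0::real"]
  proof eventually_elim
    case (elim x)
    have p: "survival F x > 0" "survival F (c * x) > 0" using pos elim c by auto
    with elim(1) have "survival F (c * x) / survival F x < C"
      by (simp add: C ennreal_less_iff)
    then have "survival F (c * x) \<le> C * survival F x" using p by (simp add: field_simps)
    also have "\<dots> \<le> (C + 1) * survival F x" using p by simp
    finally show ?case .
  qed
  then show ?thesis using that[of "C + 1"] C by simp
next
  case False
  have "\<forall>\<^sub>F x in at_top. survival F (c * x) \<le> 1 * survival F x"
    using eventually_ge_at_top[of "0::real"]
  proof eventually_elim
    case (elim x)
    have "1 * x \<le> c * x" using False elim by (intro mult_right_mono) auto
    then show ?case using antimonoD[OF anti] by simp
  qed
  then show ?thesis using that[of 1] by simp
qed

text \<open>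
  The limit that defines the index exists, since the lower limit is antitone in \<open>v\<close>; it is the
  supremum over \<open>v > 1\<close>.
\<close>

lemma L_index_properties:
  assumes D: "dominatedly_varying F" and anti: "antimono (survival F)"
    and pos: "\<And>x. x \<ge> 0 \<Longrightarrow> survival F x > 0"
  obtains l where "L_index F = ennreal l" "0 < l" "l \<le> 1"
    "\<And>s. 0 \<le> s \<Longrightarrow> s < l \<Longrightarrow> \<exists>v>1. \<forall>\<^sub>F x in at_top. s * survival F x \<le> survival F (v * x)"
proof -
  define lam where "lam v = Liminf at_top (\<lambda>x. ennreal (survival F (v * x) / survival F x))" for v
  have le1: "lam v \<le> 1" if "v \<ge> 1" for v
  proof -
    have "lam v \<le> Liminf at_top (\<lambda>x::real. 1)"
      unfolding lam_def
    proof (rule Liminf_mono)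
      show "\<forall>\<^sub>F x in at_top. ennreal (survival F (v * x) / survival F x) \<le> 1"
        using eventually_ge_at_top[of "0::real"]
      proof eventually_elim
        case (elim x)
        have "1 * x \<le> v * x" using that elim by (intro mult_right_mono) auto
        then have "survival F (v * x) \<le> survival F x" using antimonoD[OF anti] by simp
        then show ?case using pos[OF elim] by (simp add: ennreal_le_1)
      qed
    qed
    then show ?thesis by (simp add: Liminf_const)
  qed
  have mono: "lam w \<le> lam v" if "v \<le> w" for v w
    unfolding lam_def
  proof (rule Liminf_mono)
    show "\<forall>\<^sub>F x in at_top. ennreal (survival F (w * x) / survival F x) \<le> ennreal (survival F (v * x) / survival F x)"
      using eventually_ge_at_top[of "0::real"]
    proof eventually_elim
      case (elim x)
      have "v * x \<le> w * x" using that elim by (intro mult_right_mono) auto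
      then have "survival F (w * x) \<le> survival F (v * x)" using antimonoD[OF anti] by simp
      then show ?case using pos[OF elim] by (intro ennreal_leI divide_right_mono) auto
    qed
  qed
  define \<Lambda> where "\<Lambda> = (SUP v\<in>{1<..}. lam v)"
  have "(lam \<longlongrightarrow> \<Lambda>) (at_right 1)"
  proof (rule order_tendstoI)
    fix a assume "a < \<Lambda>"
    then obtain v where v: "v > 1" "a < lam v" unfolding \<Lambda>_def less_SUP_iff by auto
    have "\<forall>\<^sub>F w in at_right 1. w < v" using v(1) by (auto simp: eventually_at_right_field)
    then show "\<forall>\<^sub>F w in at_right 1. a < lam w"
    proof eventually_elim
      case (elim w)
      then show ?case using v(2) mono[of w v] by auto
    qed
  next
    fix a assume a: "a > \<Lambda>"
    have "\<forall>\<^sub>F w in at_right (1::real). w > 1" by (rule eventually_at_right_less)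
    then show "\<forall>\<^sub>F w in at_right 1. lam w < a"
    proof eventually_elim
      case (elim w)
      then have "lam w \<le> \<Lambda>" unfolding \<Lambda>_def by (intro SUP_upper) auto
      then show ?case using a by simp
    qed
  qed
  then have L: "L_index F = \<Lambda>"
    unfolding L_index_def lam_def[abs_def, symmetric] by (intro tendsto_Lim) auto
  have "\<Lambda> \<le> 1" unfolding \<Lambda>_def by (intro SUP_least le1) auto
  then obtain l where l: "\<Lambda> = ennreal l" "l \<ge> 0" by (cases \<Lambda>) (auto simp: top_unique)
  obtain C where C: "C > 0" "\<forall>\<^sub>F x in at_top. survival F (1/2 * x) \<le> C * survival F x"
    using dominatedly_varying_bound[OF D anti pos, of "1/2"] by auto
  have "filterlim (\<lambda>x::real. 2 * x) at_top at_top"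
    by (rule filterlim_tendsto_pos_mult_at_top[OF tendsto_const _ filterlim_ident]) simp
  from eventually_compose_filterlim[OF C(2) this]
  have ev: "\<forall>\<^sub>F x in at_top. survival F x \<le> C * survival F (2 * x)" by simp
  have "ennreal (1 / C) \<le> lam 2"
    unfolding lam_def
  proof (rule Liminf_bounded)
    show "\<forall>\<^sub>F x in at_top. ennreal (1 / C) \<le> ennreal (survival F (2 * x) / survival F x)"
      using ev eventually_ge_at_top[of "0::real"]
    proof eventually_elim
      case (elim x)
      have "1 / C \<le> survival F (2 * x) / survival F x"
        using elim pos[of x] C(1) by (simp add: field_simps)
      then show ?case by (rule ennreal_leI)
    qed
  qed
  also have "lam 2 \<le> \<Lambda>" unfolding \<Lambda>_def by (intro SUP_upper) auto
  finally have "l > 0" using C(1) l by (simp add: ennreal_le_iff) (smt (verit) divide_pos_pos)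
  moreover have "l \<le> 1" using \<open>\<Lambda> \<le> 1\<close> l by simp
  moreover have "\<exists>v>1. \<forall>\<^sub>F x in at_top. s * survival F x \<le> survival F (v * x)"
    if s: "0 \<le> s" "s < l" for s
  proof -
    have "ennreal s < \<Lambda>" using s l by (simp add: ennreal_less_iff)
    then obtain v where v: "v > 1" "ennreal s < lam v" unfolding \<Lambda>_def less_SUP_iff by auto
    have "\<forall>\<^sub>F x in at_top. ennreal s < ennreal (survival F (v * x) / survival F x)"
      using v(2) unfolding lam_def by (rule less_LiminfD)
    then have "\<forall>\<^sub>F x in at_top. s * survival F x \<le> survival F (v * x)"
      using eventually_ge_at_top[of "0::real"]
    proof eventually_elim
      case (elim x)
      then show ?case using pos[of x] s by (simp add: ennreal_less_iff field_simps)
    qed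
    then show ?thesis using v(1) by blast
  qed
  ultimately show ?thesis using that L l by simp
qed

section \<open>Tails of a randomly weighted variable\<close>

lemma prob_le_of_symmetric_intervals:
  assumes M: "prob_space M"
    and [measurable]: "T \<in> borel_measurable M" "Measurable.pred M A" "Measurable.pred M B"
    and S [measurable]: "S \<in> sets borel" and c: "c \<ge> 0"
    and loc: "\<And>t. t \<in> S \<Longrightarrow> \<forall>\<^sub>F d in at_right 0.
      c * \<P>(\<omega> in M. B \<omega> \<and> near1 T t d \<omega>) \<le> \<P>(\<omega> in M. A \<omega> \<and> near1 T t d \<omega>)"
  shows "c * \<P>(\<omega> in M. B \<omega> \<and> T \<omega> \<in> S) \<le> \<P>(\<omega> in M. A \<omega> \<and> T \<omega> \<in> S)"
proof -
  interpret prob_space M by fact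
  define N where "N k P = distr (density M (\<lambda>\<omega>. ennreal k * indicator {\<omega>\<in>space M. P \<omega>} \<omega>)) borel T" for k P
  have em: "emeasure (N k P) E = ennreal (k * \<P>(\<omega> in M. P \<omega> \<and> T \<omega> \<in> E))"
    if [measurable]: "Measurable.pred M P" "E \<in> sets borel" and k: "k \<ge> 0" for k P E
  proof -
    have "emeasure (N k P) E = (\<integral>\<^sup>+\<omega>. ennreal k * indicator {\<omega>\<in>space M. P \<omega>} \<omega> * indicator (T -` E \<inter> space M) \<omega> \<partial>M)"
      unfolding N_def by (subst emeasure_distr) (auto simp: emeasure_density)
    also have "\<dots> = (\<integral>\<^sup>+\<omega>. ennreal k * indicator {\<omega>\<in>space M. P \<omega> \<and> T \<omega> \<in> E} \<omega> \<partial>M)"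
      by (intro nn_integral_cong) (auto simp: indicator_def)
    also have "\<dots> = ennreal k * emeasure M {\<omega>\<in>space M. P \<omega> \<and> T \<omega> \<in> E}"
      by (rule nn_integral_cmult_indicator) measurable
    finally show ?thesis using k by (simp add: emeasure_eq_measure ennreal_mult)
  qed
  have me: "measure (N k P) E = k * \<P>(\<omega> in M. P \<omega> \<and> T \<omega> \<in> E)"
    if "Measurable.pred M P" "E \<in> sets borel" "k \<ge> 0" for k P E
    using em[OF that] that(3) by (simp add: measure_def[of "N k P"])
  have setsN: "sets (N k P) = sets borel" for k P by (simp add: N_def)
  have fin: "finite_measure (N k P)" if "Measurable.pred M P" "k \<ge> 0" for k P
  proof
    have "space (N k P) = UNIV" by (simp add: N_def)
    then show "emeasure (N k P) (space (N k P)) \<noteq> \<infinity>" using em[OF that(1) _ that(2), of UNIV] by simp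
  qed
  have "measure (N c B) S \<le> measure (N 1 A) S"
  proof (rule measure_le_of_symmetric_intervals)
    fix t assume "t \<in> S"
    from loc[OF this] show "\<forall>\<^sub>F d in at_right 0. measure (N c B) {t - d..t + d} \<le> measure (N 1 A) {t - d..t + d}"
      by (simp add: me c near1_def)
  qed (simp_all add: fin c setsN)
  then show ?thesis by (simp add: me c)
qed

text \<open>
  Condition (ii) with the limit over shrinking intervals made explicit.  Both inequalities are strict, so that
  they pass to all sufficiently small intervals.
\<close>

lemma cond_ratio_bounds:
  assumes equiv: "unif_asym_equiv (rv_support M T) at_top
      (\<lambda>x \<theta>. cond_prob_at M (\<lambda>\<omega>. X \<omega> > x) (near1 T \<theta>))
      (\<lambda>x \<theta>. h \<theta> * \<P>(\<omega> in M. X \<omega> > x))"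
    and ex: "\<forall>\<^sub>F x in at_top. \<forall>\<theta>\<in>rv_support M T. has_cond_prob M (\<lambda>\<omega>. X \<omega> > x) (near1 T \<theta>)"
    and h: "\<And>\<theta>. \<theta> \<ge> 0 \<Longrightarrow> h \<theta> > 0"
    and pos: "\<And>x. x \<ge> 0 \<Longrightarrow> \<P>(\<omega> in M. X \<omega> > x) > 0"
    and e: "e > 0"
  obtains x0 :: real where "x0 > 0" "\<And>y t. y \<ge> x0 \<Longrightarrow> t > 0 \<Longrightarrow> t \<in> rv_support M T \<Longrightarrow> \<exists>q.
    (cond_ratio M (\<lambda>\<omega>. X \<omega> > y) (near1 T t) \<longlongrightarrow> q) (at_right 0) \<and>
    (1 - e) * h t * \<P>(\<omega> in M. X \<omega> > y) < q \<and> q < (1 + e) * h t * \<P>(\<omega> in M. X \<omega> > y)"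
proof -
  have "\<forall>\<^sub>F y in at_top. \<forall>t\<in>rv_support M T.
      dist (cond_prob_at M (\<lambda>\<omega>. X \<omega> > y) (near1 T t) / (h t * \<P>(\<omega> in M. X \<omega> > y))) 1 < e"
    using equiv e unfolding unif_asym_equiv_def by (rule uniform_limitD)
  then have "\<forall>\<^sub>F y in at_top. \<forall>t\<in>rv_support M T. t > 0 \<longrightarrow> (\<exists>q.
    (cond_ratio M (\<lambda>\<omega>. X \<omega> > y) (near1 T t) \<longlongrightarrow> q) (at_right 0) \<and>
    (1 - e) * h t * \<P>(\<omega> in M. X \<omega> > y) < q \<and> q < (1 + e) * h t * \<P>(\<omega> in M. X \<omega> > y))"
    using ex eventually_ge_at_top[of "0::real"]
  proof eventually_elim
    case (elim y)
    show ?case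
    proof (intro ballI impI)
      fix t :: real assume t: "t \<in> rv_support M T" "t > 0"
      obtain q where q: "(cond_ratio M (\<lambda>\<omega>. X \<omega> > y) (near1 T t) \<longlongrightarrow> q) (at_right 0)"
        using elim(2) t by (auto simp: has_cond_prob_def)
      then have "cond_prob_at M (\<lambda>\<omega>. X \<omega> > y) (near1 T t) = q"
        unfolding cond_prob_at_def by (intro tendsto_Lim) auto
      then have "\<bar>q / (h t * \<P>(\<omega> in M. X \<omega> > y)) - 1\<bar> < e"
        using elim(1) t(1) by (auto simp: dist_real_def)
      moreover have g: "h t * \<P>(\<omega> in M. X \<omega> > y) > 0" using h[of t] pos[OF elim(3)] t(2) by simp
      ultimately have "1 - e < q / (h t * \<P>(\<omega> in M. X \<omega> > y))" "q / (h t * \<P>(\<omega> in M. X \<omega> > y)) < 1 + e"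
        by linarith+
      then have "(1 - e) * (h t * \<P>(\<omega> in M. X \<omega> > y)) < q" "q < (1 + e) * (h t * \<P>(\<omega> in M. X \<omega> > y))"
        using pos_less_divide_eq[OF g] pos_divide_less_eq[OF g] by auto
      then show "\<exists>q. (cond_ratio M (\<lambda>\<omega>. X \<omega> > y) (near1 T t) \<longlongrightarrow> q) (at_right 0) \<and>
          (1 - e) * h t * \<P>(\<omega> in M. X \<omega> > y) < q \<and> q < (1 + e) * h t * \<P>(\<omega> in M. X \<omega> > y)"
        using q by (auto simp: mult.assoc)
    qed
  qed
  then obtain x1 :: real where x1: "\<And>y. y \<ge> x1 \<Longrightarrow> \<forall>t\<in>rv_support M T. t > 0 \<longrightarrow> (\<exists>q.
    (cond_ratio M (\<lambda>\<omega>. X \<omega> > y) (near1 T t) \<longlongrightarrow> q) (at_right 0) \<and>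
    (1 - e) * h t * \<P>(\<omega> in M. X \<omega> > y) < q \<and> q < (1 + e) * h t * \<P>(\<omega> in M. X \<omega> > y))"
    unfolding eventually_at_top_linorder by blast
  show ?thesis by (rule that[of "max x1 1"]) (use x1 in auto)
qed

lemma near1_null_outside_support:
  assumes M: "prob_space M" and Tm [measurable]: "T \<in> borel_measurable M"
    and t: "t \<notin> rv_support M T"
  shows "\<forall>\<^sub>F d in at_right 0. \<P>(\<omega> in M. A \<omega> \<and> near1 T t d \<omega>) = 0"
proof -
  interpret prob_space M by fact
  obtain \<delta> where \<delta>: "\<delta> > 0" "\<P>(\<omega> in M. T \<omega> \<in> {t - \<delta>..t + \<delta>}) = 0"
    using t by (auto simp: rv_support_def not_less intro: antisym[OF _ measure_nonneg])
  have "\<forall>\<^sub>F d in at_right 0. d < \<delta>"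
    using \<delta>(1) by (auto simp: eventually_at_right_field)
  then show ?thesis
  proof eventually_elim
    case (elim d)
    have "\<P>(\<omega> in M. A \<omega> \<and> near1 T t d \<omega>) \<le> \<P>(\<omega> in M. T \<omega> \<in> {t - \<delta>..t + \<delta>})"
      using elim by (intro finite_measure_mono) (auto simp: near1_def)
    then show ?case using \<delta>(2) by (simp add: measure_le_0_iff)
  qed
qed

text \<open>
  The tail of \<open>X\<close> restricted to a small interval of weights is proportional to its unrestricted tail, up
  to the factor \<open>1 - e\<close>.  How small the interval must be depends on \<open>y\<close>, \<open>z\<close> and \<open>t\<close>, but the thresholds
  \<open>y\<close> and \<open>z\<close> are only required to exceed one common bound.
\<close>

lemma cond_tail_comparison:
  assumes M: "prob_space M" and Tm [measurable]: "T \<in> borel_measurable M"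
    and equiv: "unif_asym_equiv (rv_support M T) at_top
      (\<lambda>x \<theta>. cond_prob_at M (\<lambda>\<omega>. X \<omega> > x) (near1 T \<theta>))
      (\<lambda>x \<theta>. h \<theta> * \<P>(\<omega> in M. X \<omega> > x))"
    and ex: "\<forall>\<^sub>F x in at_top. \<forall>\<theta>\<in>rv_support M T. has_cond_prob M (\<lambda>\<omega>. X \<omega> > x) (near1 T \<theta>)"
    and h: "\<And>\<theta>. \<theta> \<ge> 0 \<Longrightarrow> h \<theta> > 0"
    and pos: "\<And>x. x \<ge> 0 \<Longrightarrow> \<P>(\<omega> in M. X \<omega> > x) > 0"
    and e: "0 < e" "e < 1"
  obtains x0 :: real where "x0 > 0" "\<And>y z t. y \<ge> x0 \<Longrightarrow> z \<ge> x0 \<Longrightarrow> t > 0 \<Longrightarrow>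
    \<forall>\<^sub>F d in at_right 0.
      (1 - e) * \<P>(\<omega> in M. X \<omega> > y) * \<P>(\<omega> in M. X \<omega> > z \<and> near1 T t d \<omega>)
      \<le> \<P>(\<omega> in M. X \<omega> > z) * \<P>(\<omega> in M. X \<omega> > y \<and> near1 T t d \<omega>)"
proof -
  interpret prob_space M by fact
  obtain x0 :: real where x0: "x0 > 0" and lim: "\<And>y t. y \<ge> x0 \<Longrightarrow> t > 0 \<Longrightarrow> t \<in> rv_support M T \<Longrightarrow> \<exists>q.
    (cond_ratio M (\<lambda>\<omega>. X \<omega> > y) (near1 T t) \<longlongrightarrow> q) (at_right 0) \<and>
    (1 - e/4) * h t * \<P>(\<omega> in M. X \<omega> > y) < q \<and> q < (1 + e/4) * h t * \<P>(\<omega> in M. X \<omega> > y)"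
    using cond_ratio_bounds[OF equiv ex h pos, of "e/4"] e by auto
  show ?thesis
  proof (rule that[OF x0])
    fix y z t :: real assume yz: "y \<ge> x0" "z \<ge> x0" and t: "t > 0"
    let ?p = "\<lambda>y. \<P>(\<omega> in M. X \<omega> > y)"
    let ?r = "\<lambda>y. cond_ratio M (\<lambda>\<omega>. X \<omega> > y) (near1 T t)"
    show "\<forall>\<^sub>F d in at_right 0.
      (1 - e) * ?p y * \<P>(\<omega> in M. X \<omega> > z \<and> near1 T t d \<omega>)
      \<le> ?p z * \<P>(\<omega> in M. X \<omega> > y \<and> near1 T t d \<omega>)"
    proof (cases "t \<in> rv_support M T")
      case False
      show ?thesis
        using near1_null_outside_support[OF M Tm False, of "\<lambda>\<omega>. X \<omega> > z"]
          near1_null_outside_support[OF M Tm False, of "\<lambda>\<omega>. X \<omega> > y"]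
        by eventually_elim simp_all
    next
      case True
      obtain q where q: "(?r y \<longlongrightarrow> q) (at_right 0)" "(1 - e/4) * h t * ?p y < q"
        using lim[OF yz(1) t True] by blast
      obtain q' where q': "(?r z \<longlongrightarrow> q') (at_right 0)" "q' < (1 + e/4) * h t * ?p z"
        using lim[OF yz(2) t True] by blast
      have p: "?p y > 0" "?p z > 0" "h t > 0" using pos yz x0 h t by auto
      have "(1 - e) * ?p y * q' < (1 - e) * ?p y * ((1 + e/4) * h t * ?p z)"
        using q'(2) p e by (intro mult_strict_left_mono) auto
      also have "\<dots> = (1 - e) * (1 + e/4) * (h t * ?p y * ?p z)" by simp
      also have "\<dots> \<le> (1 - e/4) * (h t * ?p y * ?p z)"
      proof (rule mult_right_mono)
        show "(1 - e) * (1 + e / 4) \<le> 1 - e / 4"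
          using e by (simp add: algebra_simps)
      qed (use p in auto)
      also have "\<dots> = ?p z * ((1 - e/4) * h t * ?p y)" by simp
      also have "\<dots> < ?p z * q" using q(2) p by (intro mult_strict_left_mono) auto
      finally have lt: "(1 - e) * ?p y * q' < ?p z * q" .
      have "((\<lambda>d. ?p z * ?r y d - (1 - e) * ?p y * ?r z d) \<longlongrightarrow> ?p z * q - (1 - e) * ?p y * q') (at_right 0)"
        by (intro tendsto_intros q q')
      then have "\<forall>\<^sub>F d in at_right 0. ?p z * ?r y d - (1 - e) * ?p y * ?r z d > 0"
        using lt by (intro order_tendstoD(1)) auto
      moreover have "\<forall>\<^sub>F d in at_right (0::real). d > 0" by (rule eventually_at_right_less)
      ultimately show ?thesis
      proof eventually_elim
        case (elim d)
        have "\<P>(\<omega> in M. near1 T t d \<omega>) > 0"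
          using True elim(2) by (auto simp: rv_support_def near1_def)
        then show ?case using elim(1) by (simp add: cond_ratio_def field_simps)
      qed
    qed
  qed
qed

text \<open>
  Near a weight \<open>t\<close> the event \<open>TX > x\<close> is contained in \<open>X > z\<close> with \<open>z = x / (rt)\<close>, and \<open>TX > wx\<close>
  contains \<open>X > wx / (t / r)\<close>; with \<open>w\<close> and \<open>r\<close> the square and fourth roots of \<open>v\<close>, the latter threshold is
  \<open>vz\<close>.  Boundedness of \<open>T\<close> keeps \<open>z\<close> large uniformly in \<open>t\<close>.
\<close>

lemma tail_ratio_of_product:
  assumes M: "prob_space M" and Tm [measurable]: "T \<in> borel_measurable M" and [measurable]: "X \<in> borel_measurable M"
    and T: "AE \<omega> in M. 0 \<le> T \<omega> \<and> T \<omega> \<le> K"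
    and equiv: "unif_asym_equiv (rv_support M T) at_top
      (\<lambda>x \<theta>. cond_prob_at M (\<lambda>\<omega>. X \<omega> > x) (near1 T \<theta>))
      (\<lambda>x \<theta>. h \<theta> * \<P>(\<omega> in M. X \<omega> > x))"
    and ex: "\<forall>\<^sub>F x in at_top. \<forall>\<theta>\<in>rv_support M T. has_cond_prob M (\<lambda>\<omega>. X \<omega> > x) (near1 T \<theta>)"
    and h: "\<And>\<theta>. \<theta> \<ge> 0 \<Longrightarrow> h \<theta> > 0"
    and pos: "\<And>x. x \<ge> 0 \<Longrightarrow> \<P>(\<omega> in M. X \<omega> > x) > 0"
    and e: "0 < e" "e < 1"
    and v: "v > 1" and a: "a \<ge> 0"
    and ratio: "\<forall>\<^sub>F x in at_top. a * \<P>(\<omega> in M. X \<omega> > x) \<le> \<P>(\<omega> in M. X \<omega> > v * x)"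
  shows "\<exists>w>1. \<forall>\<^sub>F x in at_top.
    (1 - e) * a * \<P>(\<omega> in M. T \<omega> * X \<omega> > x) \<le> \<P>(\<omega> in M. T \<omega> * X \<omega> > w * x)"
proof -
  interpret prob_space M by fact
  obtain x0 :: real where x0: "x0 > 0" and cmp: "\<And>y z t. y \<ge> x0 \<Longrightarrow> z \<ge> x0 \<Longrightarrow> t > 0 \<Longrightarrow>
    \<forall>\<^sub>F d in at_right 0.
      (1 - e) * \<P>(\<omega> in M. X \<omega> > y) * \<P>(\<omega> in M. X \<omega> > z \<and> near1 T t d \<omega>)
      \<le> \<P>(\<omega> in M. X \<omega> > z) * \<P>(\<omega> in M. X \<omega> > y \<and> near1 T t d \<omega>)"
    using cond_tail_comparison[OF M Tm equiv ex h pos e] by auto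
  obtain x1 :: real where x1: "\<And>x. x \<ge> x1 \<Longrightarrow> a * \<P>(\<omega> in M. X \<omega> > x) \<le> \<P>(\<omega> in M. X \<omega> > v * x)"
    using ratio by (auto simp: eventually_at_top_linorder)
  define w where "w = sqrt v"
  define r where "r = sqrt w"
  have w: "w > 1" "w * w = v" using v by (auto simp: w_def)
  have r: "r > 1" "r * r = w" using w by (auto simp: r_def)
  define K' where "K' = max K 1"
  have K': "K' > 0" "K \<le> K'" by (auto simp: K'_def)
  have main: "(1 - e) * a * \<P>(\<omega> in M. T \<omega> * X \<omega> > x) \<le> \<P>(\<omega> in M. T \<omega> * X \<omega> > w * x)"
    if x: "x \<ge> r * K' * max x0 x1" "x > 0" for x
  proof -
    have "(1 - e) * a * \<P>(\<omega> in M. T \<omega> * X \<omega> > x \<and> T \<omega> \<in> {0<..})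
        \<le> \<P>(\<omega> in M. T \<omega> * X \<omega> > w * x \<and> T \<omega> \<in> {0<..})"
    proof (rule prob_le_of_symmetric_intervals[OF M])
      fix t :: real assume "t \<in> {0<..}"
      then have t: "t > 0" by simp
      show "\<forall>\<^sub>F d in at_right 0.
        (1 - e) * a * \<P>(\<omega> in M. T \<omega> * X \<omega> > x \<and> near1 T t d \<omega>)
        \<le> \<P>(\<omega> in M. T \<omega> * X \<omega> > w * x \<and> near1 T t d \<omega>)"
      proof (cases "t \<le> K'")
        case False
        then have "t \<notin> rv_support M T"
        proof -
          have "\<P>(\<omega> in M. T \<omega> \<in> {t - (t - K')/2..t + (t - K')/2}) = 0"
          proof (rule prob_eq_0_AE)
            show "AE \<omega> in M. \<not> T \<omega> \<in> {t - (t - K')/2..t + (t - K')/2}"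
              using T
            proof eventually_elim
              case (elim \<omega>)
              then have "T \<omega> < t - (t - K') / 2" using False K' by (simp add: field_simps)
              then show ?case by simp
            qed
          qed
          moreover have "(t - K')/2 > 0" using False by simp
          ultimately show ?thesis unfolding rv_support_def by (auto intro!: exI[of _ "(t - K')/2"])
        qed
        from near1_null_outside_support[OF M Tm this, of "\<lambda>\<omega>. T \<omega> * X \<omega> > x"]
        show ?thesis by eventually_elim simp
      next
        case True
        define z where "z = x / (r * t)"
        have z: "z \<ge> max x0 x1"
        proof -
          have "max x0 x1 * (r * t) \<le> max x0 x1 * (r * K')"
            using True r t x0 by (intro mult_left_mono) auto
          also have "\<dots> \<le> x" using x(1) by (simp add: mult_ac)
          finally have "max x0 x1 * (r * t) \<le> x" .
          moreover have "r * t > 0" using r t by simp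
          ultimately show ?thesis unfolding z_def by (simp only: pos_le_divide_eq)
        qed
        have vz: "v * z \<ge> x0"
        proof -
          have "z > 0" using z x0 by simp
          then have "1 * z \<le> v * z" using v by (intro mult_right_mono) auto
          then show ?thesis using z by simp
        qed
        have zx: "z \<ge> x0" using z by simp
        have vz_eq: "v * z = w * x / (t / r)"
          unfolding z_def w(2)[symmetric] using r t by (simp add: field_simps)
        define d0 where "d0 = min (t - t / r) (t * r - t)"
        have d0: "d0 > 0" using r t by (auto simp: d0_def field_simps)
        have "\<forall>\<^sub>F d in at_right 0. d < d0" using d0 by (auto simp: eventually_at_right_field)
        with cmp[OF vz zx t] show ?thesis
        proof eventually_elim
          case (elim d)
          have d: "t / r \<le> t - d" "t + d \<le> t * r" using elim(2) by (auto simp: d0_def)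
          have up: "\<P>(\<omega> in M. T \<omega> * X \<omega> > x \<and> near1 T t d \<omega>) \<le> \<P>(\<omega> in M. X \<omega> > z \<and> near1 T t d \<omega>)"
          proof (rule finite_measure_mono)
            show "{\<omega>\<in>space M. T \<omega> * X \<omega> > x \<and> near1 T t d \<omega>} \<subseteq> {\<omega>\<in>space M. X \<omega> > z \<and> near1 T t d \<omega>}"
            proof safe
              fix \<omega> assume *: "x < T \<omega> * X \<omega>" "near1 T t d \<omega>"
              have T: "t / r \<le> T \<omega>" "T \<omega> \<le> t * r" using *(2) d by (auto simp: near1_def)
              moreover have "t / r > 0" using t r by simp
              ultimately have "T \<omega> > 0" by linarith
              with *(1) x(2) have "X \<omega> > 0" by (meson less_trans zero_less_mult_pos)
              have "T \<omega> * X \<omega> \<le> (t * r) * X \<omega>" using T \<open>X \<omega> > 0\<close> by (intro mult_right_mono) auto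
              with *(1) have "x < X \<omega> * (r * t)" by (simp add: mult_ac)
              then show "X \<omega> > z" using t r by (simp add: z_def pos_divide_less_eq)
            qed
          qed (simp add: near1_def[abs_def])
          have low: "\<P>(\<omega> in M. X \<omega> > v * z \<and> near1 T t d \<omega>) \<le> \<P>(\<omega> in M. T \<omega> * X \<omega> > w * x \<and> near1 T t d \<omega>)"
          proof (rule finite_measure_mono)
            show "{\<omega>\<in>space M. X \<omega> > v * z \<and> near1 T t d \<omega>} \<subseteq> {\<omega>\<in>space M. T \<omega> * X \<omega> > w * x \<and> near1 T t d \<omega>}"
            proof safe
              fix \<omega> assume *: "v * z < X \<omega>" "near1 T t d \<omega>"
              have T: "t / r \<le> T \<omega>" using *(2) d by (auto simp: near1_def)
              have tr: "t / r > 0" using t r by simp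
              have "w * x < X \<omega> * (t / r)" using *(1) tr unfolding vz_eq by (simp only: pos_divide_less_eq)
              also have "\<dots> \<le> X \<omega> * T \<omega>"
                using T *(1) vz x0 by (intro mult_left_mono) auto
              finally show "w * x < T \<omega> * X \<omega>" by (simp add: mult.commute)
            qed
          qed (simp add: near1_def[abs_def])
          let ?n = "\<lambda>y. \<P>(\<omega> in M. X \<omega> > y \<and> near1 T t d \<omega>)"
          have pz: "\<P>(\<omega> in M. X \<omega> > z) > 0" using pos z x0 by simp
          have "\<P>(\<omega> in M. X \<omega> > z) * ((1 - e) * a * ?n z) = (1 - e) * (a * \<P>(\<omega> in M. X \<omega> > z)) * ?n z"
            by simp
          also have "\<dots> \<le> (1 - e) * \<P>(\<omega> in M. X \<omega> > v * z) * ?n z"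
            using x1[of z] z e by (intro mult_right_mono mult_left_mono) auto
          also have "\<dots> \<le> \<P>(\<omega> in M. X \<omega> > z) * ?n (v * z)" using elim(1) z by simp
          finally have "(1 - e) * a * ?n z \<le> ?n (v * z)" using pz by simp
          moreover have "(1 - e) * a * \<P>(\<omega> in M. T \<omega> * X \<omega> > x \<and> near1 T t d \<omega>) \<le> (1 - e) * a * ?n z"
            using up e a by (intro mult_left_mono) auto
          ultimately show ?case using low by linarith
        qed
      qed
    qed (use e a in auto)
    moreover have "\<P>(\<omega> in M. T \<omega> * X \<omega> > u \<and> T \<omega> \<in> {0<..}) = \<P>(\<omega> in M. T \<omega> * X \<omega> > u)" if "u > 0" for u
    proof (rule prob_eq_AE)
      show "AE \<omega> in M. (T \<omega> * X \<omega> > u \<and> T \<omega> \<in> {0<..}) = (T \<omega> * X \<omega> > u)"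
        using T by eventually_elim (use that in \<open>auto simp: less_le\<close>)
    qed auto
    ultimately show ?thesis using x(2) w by simp
  qed
  have "\<forall>\<^sub>F x in at_top.
    (1 - e) * a * \<P>(\<omega> in M. T \<omega> * X \<omega> > x) \<le> \<P>(\<omega> in M. T \<omega> * X \<omega> > w * x)"
    using eventually_ge_at_top[of "r * K' * max x0 x1"] eventually_gt_at_top[of "0::real"]
    by eventually_elim (rule main)
  then show ?thesis using w by blast
qed

text \<open>
  It suffices to consider \<open>T > a\<close> for some \<open>a\<close> that \<open>T\<close> exceeds with positive probability: there
  \<open>X > x / a\<close> implies \<open>TX > x\<close>, and the tail of \<open>X\<close> on \<open>T > a\<close> is comparable to its full tail.
\<close>

lemma tail_of_product_lower_bound:
  assumes M: "prob_space M" and Tm [measurable]: "T \<in> borel_measurable M" and [measurable]: "X \<in> borel_measurable M"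
    and T: "AE \<omega> in M. 0 \<le> T \<omega>" "\<not> (AE \<omega> in M. T \<omega> = 0)"
    and equiv: "unif_asym_equiv (rv_support M T) at_top
      (\<lambda>x \<theta>. cond_prob_at M (\<lambda>\<omega>. X \<omega> > x) (near1 T \<theta>))
      (\<lambda>x \<theta>. h \<theta> * \<P>(\<omega> in M. X \<omega> > x))"
    and ex: "\<forall>\<^sub>F x in at_top. \<forall>\<theta>\<in>rv_support M T. has_cond_prob M (\<lambda>\<omega>. X \<omega> > x) (near1 T \<theta>)"
    and h: "\<And>\<theta>. \<theta> \<ge> 0 \<Longrightarrow> h \<theta> > 0"
    and pos: "\<And>x. x \<ge> 0 \<Longrightarrow> \<P>(\<omega> in M. X \<omega> > x) > 0"
    and dom: "\<And>c. c > 0 \<Longrightarrow> \<exists>C>0. \<forall>\<^sub>F x in at_top. \<P>(\<omega> in M. X \<omega> > c * x) \<le> C * \<P>(\<omega> in M. X \<omega> > x)"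
  shows "\<exists>c>0. \<forall>\<^sub>F x in at_top. c * \<P>(\<omega> in M. X \<omega> > x) \<le> \<P>(\<omega> in M. T \<omega> * X \<omega> > x)"
proof -
  interpret prob_space M by fact
  obtain a where a: "a > 0" "\<P>(\<omega> in M. T \<omega> > a) > 0"
  proof -
    have "\<exists>m::nat. \<P>(\<omega> in M. T \<omega> > 1 / Suc m) > 0"
    proof (rule ccontr)
      assume "\<not> ?thesis"
      then have "\<P>(\<omega> in M. T \<omega> > 1 / Suc m) = 0" for m :: nat
        by (metis measure_nonneg antisym_conv1 order_le_less)
      then have "AE \<omega> in M. \<not> T \<omega> > 1 / Suc m" for m :: nat
        by (subst (asm) prob_eq_0) auto
      then have "AE \<omega> in M. \<forall>m::nat. \<not> T \<omega> > 1 / Suc m" unfolding AE_all_countable by blast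
      with T(1) have "AE \<omega> in M. T \<omega> = 0"
      proof eventually_elim
        case (elim \<omega>)
        show ?case
        proof (rule ccontr)
          assume "T \<omega> \<noteq> 0"
          with elim(1) have "T \<omega> > 0" by simp
          then obtain m where "inverse (of_nat (Suc m)) < T \<omega>" using reals_Archimedean by blast
          with elim(2) show False by (auto simp: inverse_eq_divide)
        qed
      qed
      with T(2) show False by contradiction
    qed
    then show ?thesis using that[of "1 / real (Suc _)"] by (metis zero_less_divide_1_iff of_nat_0_less_iff zero_less_Suc)
  qed
  obtain x0 :: real where x0: "x0 > 0" and cmp: "\<And>y z t. y \<ge> x0 \<Longrightarrow> z \<ge> x0 \<Longrightarrow> t > 0 \<Longrightarrow>
    \<forall>\<^sub>F d in at_right 0.
      (1 - 1/2) * \<P>(\<omega> in M. X \<omega> > y) * \<P>(\<omega> in M. X \<omega> > z \<and> near1 T t d \<omega>)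
      \<le> \<P>(\<omega> in M. X \<omega> > z) * \<P>(\<omega> in M. X \<omega> > y \<and> near1 T t d \<omega>)"
    using cond_tail_comparison[OF M Tm equiv ex h pos, of "1/2"] by auto
  obtain x1 :: real where x1: "x1 > 0" and lim: "\<And>y t. y \<ge> x1 \<Longrightarrow> t > 0 \<Longrightarrow> t \<in> rv_support M T \<Longrightarrow> \<exists>q.
    (cond_ratio M (\<lambda>\<omega>. X \<omega> > y) (near1 T t) \<longlongrightarrow> q) (at_right 0) \<and>
    (1 - 1/2) * h t * \<P>(\<omega> in M. X \<omega> > y) < q \<and> q < (1 + 1/2) * h t * \<P>(\<omega> in M. X \<omega> > y)"
    using cond_ratio_bounds[OF equiv ex h pos, of "1/2"] by auto
  define z where "z = max x0 x1"
  have z: "z \<ge> x0" "z \<ge> x1" "z > 0" using x0 by (auto simp: z_def)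
  have zpos: "\<P>(\<omega> in M. X \<omega> > z \<and> T \<omega> \<in> {a<..}) > 0"
  proof (rule ccontr)
    assume "\<not> ?thesis"
    then have 0: "\<P>(\<omega> in M. X \<omega> > z \<and> T \<omega> \<in> {a<..}) = 0"
      by (simp add: not_less measure_le_0_iff)
    \<comment> \<open>conditional tails are positive on the support, so no point beyond \<open>a\<close> would lie in it\<close>
    have "1 * \<P>(\<omega> in M. True \<and> T \<omega> \<in> {a<..}) \<le> \<P>(\<omega> in M. X \<omega> > z \<and> T \<omega> \<in> {a<..})"
    proof (rule prob_le_of_symmetric_intervals[OF M])
      fix t assume "t \<in> {a<..}"
      then have t: "t > a" "t > 0" using a by auto
      have "t \<notin> rv_support M T"
      proof
        assume "t \<in> rv_support M T"
        then obtain q where q: "(cond_ratio M (\<lambda>\<omega>. X \<omega> > z) (near1 T t) \<longlongrightarrow> q) (at_right 0)"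
            "(1 - 1/2) * h t * \<P>(\<omega> in M. X \<omega> > z) < q"
          using lim[OF z(2) t(2)] by blast
        have "\<forall>\<^sub>F d in at_right 0. d < t - a" using t by (auto simp: eventually_at_right_field intro!: exI[of _ "t - a"])
        then have "\<forall>\<^sub>F d in at_right 0. cond_ratio M (\<lambda>\<omega>. X \<omega> > z) (near1 T t) d = 0"
        proof eventually_elim
          case (elim d)
          have "\<P>(\<omega> in M. X \<omega> > z \<and> near1 T t d \<omega>) \<le> \<P>(\<omega> in M. X \<omega> > z \<and> T \<omega> \<in> {a<..})"
            using elim by (intro finite_measure_mono) (auto simp: near1_def)
          then show ?case using 0 by (simp add: cond_ratio_def measure_le_0_iff)
        qed
        then have "(cond_ratio M (\<lambda>\<omega>. X \<omega> > z) (near1 T t) \<longlongrightarrow> 0) (at_right 0)"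
          by (rule tendsto_eventually)
        then have "q = 0" using tendsto_unique[OF _ q(1)] by auto
        moreover have "(1 - 1/2) * h t * \<P>(\<omega> in M. X \<omega> > z) > 0"
          using h[of t] pos[of z] t z by simp
        ultimately show False using q(2) by simp
      qed
      from near1_null_outside_support[OF M Tm this, of "\<lambda>_. True"]
      show "\<forall>\<^sub>F d in at_right 0. 1 * \<P>(\<omega> in M. True \<and> near1 T t d \<omega>) \<le> \<P>(\<omega> in M. X \<omega> > z \<and> near1 T t d \<omega>)"
        by eventually_elim simp
    qed auto
    then show False using a(2) 0 by simp
  qed
  define k where "k = \<P>(\<omega> in M. X \<omega> > z \<and> T \<omega> \<in> {a<..}) / (2 * \<P>(\<omega> in M. X \<omega> > z))"
  have pz: "\<P>(\<omega> in M. X \<omega> > z) > 0" using pos z by simp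
  have k: "k > 0" using zpos pz by (simp add: k_def)
  have low: "k * \<P>(\<omega> in M. X \<omega> > y) \<le> \<P>(\<omega> in M. X \<omega> > y \<and> T \<omega> \<in> {a<..})" if y: "y \<ge> x0" for y
  proof -
    have "(1/2 * \<P>(\<omega> in M. X \<omega> > y) / \<P>(\<omega> in M. X \<omega> > z)) * \<P>(\<omega> in M. X \<omega> > z \<and> T \<omega> \<in> {a<..})
        \<le> \<P>(\<omega> in M. X \<omega> > y \<and> T \<omega> \<in> {a<..})"
    proof (rule prob_le_of_symmetric_intervals[OF M])
      fix t assume "t \<in> {a<..}"
      then have "t > 0" using a by auto
      from cmp[OF y z(1) this]
      show "\<forall>\<^sub>F d in at_right 0. (1/2 * \<P>(\<omega> in M. X \<omega> > y) / \<P>(\<omega> in M. X \<omega> > z)) * \<P>(\<omega> in M. X \<omega> > z \<and> near1 T t d \<omega>)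
          \<le> \<P>(\<omega> in M. X \<omega> > y \<and> near1 T t d \<omega>)"
        by eventually_elim (use pz in \<open>simp add: field_simps\<close>)
    qed auto
    then show ?thesis by (simp add: k_def field_simps)
  qed
  obtain C where C: "C > 0" "\<forall>\<^sub>F x in at_top. \<P>(\<omega> in M. X \<omega> > a * x) \<le> C * \<P>(\<omega> in M. X \<omega> > x)"
    using dom[OF a(1)] by blast
  have "filterlim (\<lambda>x. x * (1 / a)) at_top at_top"
    using a(1) by (intro filterlim_at_top_mult_tendsto_pos[OF tendsto_const _ filterlim_ident]) simp
  then have fl: "filterlim (\<lambda>x. x / a) at_top at_top" by simp
  have "\<forall>\<^sub>F x in at_top. k / C * \<P>(\<omega> in M. X \<omega> > x) \<le> \<P>(\<omega> in M. T \<omega> * X \<omega> > x)"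
    using eventually_compose_filterlim[OF C(2) fl] eventually_compose_filterlim[OF eventually_ge_at_top[of x0] fl]
      eventually_gt_at_top[of "0::real"]
  proof eventually_elim
    case (elim x)
    have "k / C * \<P>(\<omega> in M. X \<omega> > x) \<le> k * \<P>(\<omega> in M. X \<omega> > x / a)"
      using elim(1) a(1) k C(1) by (simp add: field_simps)
    also have "\<dots> \<le> \<P>(\<omega> in M. X \<omega> > x / a \<and> T \<omega> \<in> {a<..})" using low elim(2) by blast
    also have "\<dots> \<le> \<P>(\<omega> in M. T \<omega> * X \<omega> > x)"
    proof (rule finite_measure_mono)
      show "{\<omega>\<in>space M. X \<omega> > x / a \<and> T \<omega> \<in> {a<..}} \<subseteq> {\<omega>\<in>space M. T \<omega> * X \<omega> > x}"
      proof safe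
        fix \<omega> assume *: "x / a < X \<omega>" "a < T \<omega>"
        have "X \<omega> > 0" using *(1) elim(3) a(1) by (meson divide_pos_pos less_trans)
        have "x < a * X \<omega>" using *(1) a(1) by (simp add: field_simps)
        also have "\<dots> < T \<omega> * X \<omega>" using *(2) \<open>X \<omega> > 0\<close> by simp
        finally show "x < T \<omega> * X \<omega>" .
      qed
    qed simp
    finally show ?case .
  qed
  moreover have "k / C > 0" using k C by simp
  ultimately show ?thesis by blast
qed

section \<open>Joint tails of weighted variables\<close>

lemma tail_prob_tendsto_0:
  fixes Y :: "'a \<Rightarrow> real"
  assumes "prob_space M" "Y \<in> borel_measurable M"
  shows "((\<lambda>y. \<P>(\<omega> in M. Y \<omega> > y)) \<longlongrightarrow> 0) at_top"
proof -
  interpret prob_space M by fact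
  interpret D: real_distribution "distr M borel Y"
    using assms by (intro real_distribution_distr) simp
  have "((\<lambda>y. 1 - cdf (distr M borel Y) y) \<longlongrightarrow> 1 - 1) at_top"
    by (intro tendsto_intros D.cdf_lim_at_top_prob)
  then show ?thesis
    by (simp add: survival_eq_prob[OF assms, symmetric] survival_def)
qed

text \<open>
  The hypothesis is uniform in pairs of large thresholds, so \<open>x\<close> may be held fixed while \<open>y\<close> tends
  to infinity.
\<close>

lemma weight_bounded:
  fixes T W Y :: "'a \<Rightarrow> real"
  assumes M: "prob_space M"
    and [measurable]: "T \<in> borel_measurable M" "W \<in> borel_measurable M" "Y \<in> borel_measurable M"
    and small: "(\<lambda>(x, y). \<P>(\<omega> in M. T \<omega> > b x))
      \<in> o[min_at_top](\<lambda>(x, y). \<P>(\<omega> in M. W \<omega> > x \<and> Y \<omega> > y))"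
  obtains K where "AE \<omega> in M. T \<omega> \<le> K"
proof -
  interpret prob_space M by fact
  have "\<forall>\<^sub>F p in min_at_top. norm ((\<lambda>(x, y). \<P>(\<omega> in M. T \<omega> > b x)) p)
      \<le> 1 * norm ((\<lambda>(x, y). \<P>(\<omega> in M. W \<omega> > x \<and> Y \<omega> > y)) p)"
    by (rule landau_o.smallD[OF small]) simp
  then obtain Q where Q: "eventually Q at_top"
    "\<And>x y. Q (min x y) \<Longrightarrow> \<P>(\<omega> in M. T \<omega> > b x) \<le> \<P>(\<omega> in M. W \<omega> > x \<and> Y \<omega> > y)"
    unfolding min_at_top_def eventually_filtercomap by auto
  obtain N where N: "\<And>u. u \<ge> N \<Longrightarrow> Q u" using Q(1) by (auto simp: eventually_at_top_linorder)
  have "\<forall>\<^sub>F y in at_top. \<P>(\<omega> in M. T \<omega> > b N) \<le> \<P>(\<omega> in M. Y \<omega> > y)"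
    using eventually_ge_at_top[of N]
  proof eventually_elim
    case (elim y)
    have "\<P>(\<omega> in M. T \<omega> > b N) \<le> \<P>(\<omega> in M. W \<omega> > N \<and> Y \<omega> > y)"
      using elim by (intro Q N) simp
    also have "\<dots> \<le> \<P>(\<omega> in M. Y \<omega> > y)" by (intro finite_measure_mono) auto
    finally show ?case .
  qed
  then have "\<P>(\<omega> in M. T \<omega> > b N) \<le> 0"
    by (intro tendsto_lowerbound[OF tail_prob_tendsto_0[OF M, of Y]]) auto
  then have "\<P>(\<omega> in M. T \<omega> > b N) = 0" by (simp add: measure_le_0_iff)
  then have "AE \<omega> in M. \<not> T \<omega> > b N" by (subst (asm) prob_eq_0) auto
  then show ?thesis by (intro that[of "b N"]) (auto simp: not_less)
qed

lemma joint_tail_of_products: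
  fixes X Y S T :: "'a \<Rightarrow> real"
  assumes M: "prob_space M"
    and [measurable]: "X \<in> borel_measurable M" "Y \<in> borel_measurable M"
      "S \<in> borel_measurable M" "T \<in> borel_measurable M"
    and S: "AE \<omega> in M. 0 \<le> S \<omega> \<and> S \<omega> \<le> K" and T: "AE \<omega> in M. 0 \<le> T \<omega> \<and> T \<omega> \<le> K'"
    and qai: "((\<lambda>x. \<P>(\<omega> in M. max (X \<omega>) 0 > x \<and> max (Y \<omega>) 0 > x)
              / (\<P>(\<omega> in M. X \<omega> > x) + \<P>(\<omega> in M. Y \<omega> > x))) \<longlongrightarrow> 0) at_top"
      "((\<lambda>x. \<P>(\<omega> in M. - min (X \<omega>) 0 > x \<and> Y \<omega> > x)
              / (\<P>(\<omega> in M. X \<omega> > x) + \<P>(\<omega> in M. Y \<omega> > x))) \<longlongrightarrow> 0) at_top"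
    and pos: "\<And>x. x \<ge> 0 \<Longrightarrow> \<P>(\<omega> in M. X \<omega> > x) > 0"
    and domX: "\<And>c. c > 0 \<Longrightarrow> \<exists>C>0. \<forall>\<^sub>F x in at_top. \<P>(\<omega> in M. X \<omega> > c * x) \<le> C * \<P>(\<omega> in M. X \<omega> > x)"
    and domY: "\<And>c. c > 0 \<Longrightarrow> \<exists>C>0. \<forall>\<^sub>F x in at_top. \<P>(\<omega> in M. Y \<omega> > c * x) \<le> C * \<P>(\<omega> in M. Y \<omega> > x)"
    and lowX: "\<exists>c>0. \<forall>\<^sub>F x in at_top. c * \<P>(\<omega> in M. X \<omega> > x) \<le> \<P>(\<omega> in M. S \<omega> * X \<omega> > x)"
    and lowY: "\<exists>c>0. \<forall>\<^sub>F x in at_top. c * \<P>(\<omega> in M. Y \<omega> > x) \<le> \<P>(\<omega> in M. T \<omega> * Y \<omega> > x)"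
    and k: "k > 0" and \<eta>: "\<eta> > 0"
  shows "\<forall>\<^sub>F x in at_top. \<P>(\<omega> in M. \<bar>S \<omega> * X \<omega>\<bar> > k * x \<and> T \<omega> * Y \<omega> > k * x)
      \<le> \<eta> * (\<P>(\<omega> in M. S \<omega> * X \<omega> > x) + \<P>(\<omega> in M. T \<omega> * Y \<omega> > x))"
proof -
  interpret prob_space M by fact
  define B where "B = max 1 (max K K')"
  have B: "B \<ge> 1" "B \<ge> K" "B \<ge> K'" by (auto simp: B_def)
  define r where "r = k / B"
  have r: "r > 0" using k B by (simp add: r_def)
  obtain C where C: "C > 0" "\<forall>\<^sub>F x in at_top. \<P>(\<omega> in M. X \<omega> > r * x) \<le> C * \<P>(\<omega> in M. X \<omega> > x)"
    using domX[OF r] by blast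
  obtain C' where C': "C' > 0" "\<forall>\<^sub>F x in at_top. \<P>(\<omega> in M. Y \<omega> > r * x) \<le> C' * \<P>(\<omega> in M. Y \<omega> > x)"
    using domY[OF r] by blast
  obtain c where c: "c > 0" "\<forall>\<^sub>F x in at_top. c * \<P>(\<omega> in M. X \<omega> > x) \<le> \<P>(\<omega> in M. S \<omega> * X \<omega> > x)"
    using lowX by blast
  obtain c' where c': "c' > 0" "\<forall>\<^sub>F x in at_top. c' * \<P>(\<omega> in M. Y \<omega> > x) \<le> \<P>(\<omega> in M. T \<omega> * Y \<omega> > x)"
    using lowY by blast
  define D where "D = max (C / c) (C' / c')"
  have "C / c > 0" using C c by simp
  then have D: "D > 0" "C / c \<le> D" "C' / c' \<le> D" by (auto simp: D_def)
  define e where "e = \<eta> / (2 * D)"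
  have e: "e > 0" using \<eta> D by (simp add: e_def)
  have fl: "filterlim (\<lambda>x. r * x) at_top at_top"
    by (rule filterlim_tendsto_pos_mult_at_top[OF tendsto_const r filterlim_ident])
  note q = eventually_compose_filterlim[OF order_tendstoD(2)[OF qai(1) e] fl]
    eventually_compose_filterlim[OF order_tendstoD(2)[OF qai(2) e] fl]
  show ?thesis
    using q C(2) C'(2) c(2) c'(2) eventually_gt_at_top[of "0::real"]
  proof eventually_elim
    case (elim x)
    define y where "y = r * x"
    have y: "y > 0" using r elim(7) by (simp add: y_def)
    let ?p = "\<P>(\<omega> in M. X \<omega> > y)" and ?q = "\<P>(\<omega> in M. Y \<omega> > y)"
    have den: "?p + ?q > 0" using pos[of y] y by (simp add: add_pos_nonneg)
    have "\<P>(\<omega> in M. \<bar>S \<omega> * X \<omega>\<bar> > k * x \<and> T \<omega> * Y \<omega> > k * x)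
        \<le> \<P>(\<omega> in M. (max (X \<omega>) 0 > y \<and> max (Y \<omega>) 0 > y) \<or> (- min (X \<omega>) 0 > y \<and> Y \<omega> > y))"
    proof (rule finite_measure_mono_AE)
      show "AE \<omega> in M. \<omega> \<in> {\<omega> \<in> space M. \<bar>S \<omega> * X \<omega>\<bar> > k * x \<and> T \<omega> * Y \<omega> > k * x} \<longrightarrow>
          \<omega> \<in> {\<omega> \<in> space M. (max (X \<omega>) 0 > y \<and> max (Y \<omega>) 0 > y) \<or> (- min (X \<omega>) 0 > y \<and> Y \<omega> > y)}"
        using S T
      proof eventually_elim
        case (elim \<omega>)
        have kx: "k * x = B * y" using B by (simp add: y_def r_def)
        have *: "y < \<bar>u\<bar>" if "0 \<le> s" "s \<le> B" "B * y < \<bar>s * u\<bar>" for s u :: real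
        proof (rule ccontr)
          assume "\<not> y < \<bar>u\<bar>"
          then have "s * \<bar>u\<bar> \<le> B * y" using that B by (intro mult_mono) auto
          then show False using that by (simp add: abs_mult)
        qed
        show ?case
        proof (intro impI)
          assume "\<omega> \<in> {\<omega> \<in> space M. \<bar>S \<omega> * X \<omega>\<bar> > k * x \<and> T \<omega> * Y \<omega> > k * x}"
          then have h: "\<omega> \<in> space M" "\<bar>S \<omega> * X \<omega>\<bar> > B * y" "T \<omega> * Y \<omega> > B * y" by (auto simp: kx)
          have "y < \<bar>X \<omega>\<bar>" using * h(2) elim B by force
          moreover have "B * y < \<bar>T \<omega> * Y \<omega>\<bar>" using h(3) by linarith
          then have "y < \<bar>Y \<omega>\<bar>" using * elim B by force
          moreover have "T \<omega> * Y \<omega> > 0" using h(3) B y by (smt (verit) mult_pos_pos)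
          then have "Y \<omega> > 0" using elim by (simp add: zero_less_mult_iff)
          ultimately show "\<omega> \<in> {\<omega> \<in> space M. (max (X \<omega>) 0 > y \<and> max (Y \<omega>) 0 > y) \<or> (- min (X \<omega>) 0 > y \<and> Y \<omega> > y)}"
            using h(1) y by (auto simp: max_def min_def)
        qed
      qed
    qed simp
    also have "\<dots> \<le> \<P>(\<omega> in M. max (X \<omega>) 0 > y \<and> max (Y \<omega>) 0 > y) + \<P>(\<omega> in M. - min (X \<omega>) 0 > y \<and> Y \<omega> > y)"
    proof -
      have "{\<omega>\<in>space M. (max (X \<omega>) 0 > y \<and> max (Y \<omega>) 0 > y) \<or> (- min (X \<omega>) 0 > y \<and> Y \<omega> > y)}
        = {\<omega>\<in>space M. max (X \<omega>) 0 > y \<and> max (Y \<omega>) 0 > y} \<union> {\<omega>\<in>space M. - min (X \<omega>) 0 > y \<and> Y \<omega> > y}"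
        by blast
      then show ?thesis by (simp add: measure_Un_le)
    qed
    also have "\<dots> \<le> e * (?p + ?q) + e * (?p + ?q)"
      using elim(1,2) den unfolding y_def[symmetric]
      by (intro add_mono) (simp_all add: pos_divide_less_eq less_imp_le)
    also have "\<dots> = 2 * e * (?p + ?q)" by simp
    also have "\<dots> \<le> 2 * e * (D * (\<P>(\<omega> in M. S \<omega> * X \<omega> > x) + \<P>(\<omega> in M. T \<omega> * Y \<omega> > x)))"
    proof (rule mult_left_mono)
      have "?p \<le> C * \<P>(\<omega> in M. X \<omega> > x)" using elim(3) by (simp add: y_def)
      also have "\<dots> \<le> C / c * \<P>(\<omega> in M. S \<omega> * X \<omega> > x)"
        using elim(5) C(1) c(1) by (simp add: field_simps)
      also have "\<dots> \<le> D * \<P>(\<omega> in M. S \<omega> * X \<omega> > x)" using D by (intro mult_right_mono) auto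
      finally have 1: "?p \<le> D * \<P>(\<omega> in M. S \<omega> * X \<omega> > x)" .
      have "?q \<le> C' * \<P>(\<omega> in M. Y \<omega> > x)" using elim(4) by (simp add: y_def)
      also have "\<dots> \<le> C' / c' * \<P>(\<omega> in M. T \<omega> * Y \<omega> > x)"
        using elim(6) C'(1) c'(1) by (simp add: field_simps)
      also have "\<dots> \<le> D * \<P>(\<omega> in M. T \<omega> * Y \<omega> > x)" using D by (intro mult_right_mono) auto
      finally show "?p + ?q \<le> D * (\<P>(\<omega> in M. S \<omega> * X \<omega> > x) + \<P>(\<omega> in M. T \<omega> * Y \<omega> > x))"
        using 1 by (simp add: distrib_left)
    qed (use e in auto)
    also have "\<dots> = \<eta> * (\<P>(\<omega> in M. S \<omega> * X \<omega> > x) + \<P>(\<omega> in M. T \<omega> * Y \<omega> > x))"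
      using D by (simp add: e_def)
    finally show ?case .
  qed
qed

section \<open>Tail probability of a sum\<close>

lemma exists_summand_gt:
  fixes f :: "'i \<Rightarrow> real"
  assumes "finite A" "real (card A) \<le> N" "N > 0" "u \<ge> 0" "(\<Sum>i\<in>A. f i) > u"
  shows "\<exists>i\<in>A. f i > u / N"
proof (rule ccontr)
  assume "\<not> ?thesis"
  then have "(\<Sum>i\<in>A. f i) \<le> (\<Sum>i\<in>A. u / N)" by (intro sum_mono) (auto simp: not_less)
  also have "\<dots> = real (card A) * (u / N)" by simp
  also have "\<dots> \<le> N * (u / N)" using assms by (intro mult_right_mono) auto
  finally show False using assms by simp
qed

text \<open>
  The principle of a single big jump.  The hypotheses are that multiplying the level by some
  \<open>w > 1\<close> reduces the \<open>i\<close>-th tail at most by a factor close to \<open>l\<^sub>i\<close>, and that joint tails are negligible at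
  every scale.  With \<open>d = 1 - 1 / w\<close> and \<open>k = d / N\<close>, where \<open>N\<close> exceeds the
  number of summands: for the upper bound, if the sum exceeds \<open>x\<close> but no summand exceeds \<open>x / w\<close>, then two summands
  exceed \<open>kx\<close>; for the lower bound, the disjoint events that one summand exceeds \<open>wx\<close> and all others are
  at most \<open>kx\<close> in absolute value imply that the sum exceeds \<open>x\<close>.
\<close>

lemma tail_of_sum:
  fixes W :: "'i \<Rightarrow> 'a \<Rightarrow> real" and l :: "'i \<Rightarrow> real"
  assumes M: "prob_space M" and I: "finite I"
    and W: "\<And>i. i \<in> I \<Longrightarrow> W i \<in> borel_measurable M"
    and l: "\<And>i. i \<in> I \<Longrightarrow> 0 < l i" "\<And>i. i \<in> I \<Longrightarrow> l i \<le> 1"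
    and ratio: "\<And>i s. i \<in> I \<Longrightarrow> 0 < s \<Longrightarrow> s < l i \<Longrightarrow>
      \<exists>w>1. \<forall>\<^sub>F x in at_top. s * \<P>(\<omega> in M. W i \<omega> > x) \<le> \<P>(\<omega> in M. W i \<omega> > w * x)"
    and joint: "\<And>i j k \<eta>. i \<in> I \<Longrightarrow> j \<in> I \<Longrightarrow> i \<noteq> j \<Longrightarrow> k > 0 \<Longrightarrow> \<eta> > 0 \<Longrightarrow>
      \<forall>\<^sub>F x in at_top. \<P>(\<omega> in M. \<bar>W i \<omega>\<bar> > k * x \<and> W j \<omega> > k * x)
        \<le> \<eta> * (\<P>(\<omega> in M. W i \<omega> > x) + \<P>(\<omega> in M. W j \<omega> > x))"
    and e: "e > 0"
  shows "\<forall>\<^sub>F x in at_top.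
      (1 - e) * (\<Sum>i\<in>I. l i * \<P>(\<omega> in M. W i \<omega> > x)) \<le> \<P>(\<omega> in M. (\<Sum>i\<in>I. W i \<omega>) > x) \<and>
      \<P>(\<omega> in M. (\<Sum>i\<in>I. W i \<omega>) > x) \<le> (1 + e) * (\<Sum>i\<in>I. (1 / l i) * \<P>(\<omega> in M. W i \<omega> > x))"
proof -
  interpret prob_space M by fact
  note W [measurable]
  define p where "p i x = \<P>(\<omega> in M. W i \<omega> > x)" for i x
  \<comment> \<open>chosen so that \<open>1 / s\<^sub>i = (1 + e / 2) / l\<^sub>i\<close> and \<open>(1 - e / 2) l\<^sub>i \<le> s\<^sub>i\<close>; the other half of \<open>e\<close> absorbs the joint tails\<close>
  define s where "s i = l i / (1 + e / 2)" for i
  have s: "0 < s i" "s i < l i" if "i \<in> I" for i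
    using l(1)[OF that] e by (auto simp: s_def field_simps)
  have "\<forall>i\<in>I. \<exists>w>1. \<forall>\<^sub>F x in at_top. s i * p i x \<le> p i (w * x)"
    unfolding p_def using ratio s by blast
  then obtain w' where w': "\<And>i. i \<in> I \<Longrightarrow> w' i > 1"
    "\<And>i. i \<in> I \<Longrightarrow> \<forall>\<^sub>F x in at_top. s i * p i x \<le> p i (w' i * x)" by metis
  define w where "w = Min (insert 2 (w' ` I))"
  have w: "w > 1" using I w'(1) by (auto simp: w_def)
  have ww': "w \<le> w' i" if "i \<in> I" for i using I that by (auto simp: w_def)
  have "\<forall>\<^sub>F x in at_top. s i * p i x \<le> p i (w * x)" if i: "i \<in> I" for i
    using w'(2)[OF i] eventually_ge_at_top[of "0::real"]
  proof eventually_elim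
    case (elim x)
    have "w * x \<le> w' i * x" using ww'[OF i] elim(2) by (rule mult_right_mono)
    then have "p i (w' i * x) \<le> p i (w * x)"
      unfolding p_def using i by (intro finite_measure_mono) auto
    with elim(1) show ?case by simp
  qed
  then have ev_w: "\<forall>\<^sub>F x in at_top. \<forall>i\<in>I. s i * p i x \<le> p i (w * x)"
    using I by (simp add: eventually_ball_finite)
  have fl: "filterlim (\<lambda>x. 1 / w * x) at_top at_top"
    by (rule filterlim_tendsto_pos_mult_at_top[OF tendsto_const _ filterlim_ident]) (use w in simp)
  have ev_w': "\<forall>\<^sub>F x in at_top. \<forall>i\<in>I. s i * p i (x / w) \<le> p i x"
    using eventually_compose_filterlim[OF ev_w fl] w by simp
  define N where "N = real (card I) + 1"
  have N: "N \<ge> 1" "real (card I) \<le> N" by (auto simp: N_def)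
  define d where "d = 1 - 1 / w"
  have "d = (w - 1) / w" using w by (simp add: d_def diff_divide_distrib)
  moreover have "(w - 1) * 1 < (w - 1) * w" using w by (intro mult_strict_left_mono) auto
  ultimately have d: "0 < d" "d < 1" "d < w - 1"
    using w by (auto simp: divide_less_eq)
  define k where "k = d / N"
  have k: "0 < k" "k < 1" "N * k = d" "k \<le> 1 / N"
    using d N by (auto simp: k_def field_simps)
  define m where "m = Min (insert 1 (l ` I))"
  have m: "0 < m" "m \<le> 1" "\<And>i. i \<in> I \<Longrightarrow> m \<le> l i" using I l by (auto simp: m_def)
  define \<eta> where "\<eta> = e * m / (4 * N)"
  have \<eta>: "\<eta> > 0" using e m N by (simp add: \<eta>_def)
  define J where "J i j x = \<P>(\<omega> in M. \<bar>W i \<omega>\<bar> > k * x \<and> W j \<omega> > k * x)" for i j x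
  have ev_J: "\<forall>\<^sub>F x in at_top. \<forall>i\<in>I. \<forall>j\<in>I - {i}. J i j x \<le> \<eta> * (p i x + p j x)"
    unfolding J_def p_def
    by (intro eventually_ball_finite ballI joint k \<eta>) (use I in auto)
  show ?thesis
    using ev_w ev_w' ev_J eventually_gt_at_top[of "0::real"]
  proof eventually_elim
    case (elim x)
    have p0: "p i x \<ge> 0" for i x by (simp add: p_def)
    have sumJ: "(\<Sum>i\<in>I. \<Sum>j\<in>I - {i}. J i j x) \<le> (e / 2) * (m * (\<Sum>i\<in>I. p i x))"
    proof -
      have "(\<Sum>i\<in>I. \<Sum>j\<in>I - {i}. J i j x) \<le> (\<Sum>i\<in>I. \<Sum>j\<in>I - {i}. \<eta> * (p i x + p j x))"
        using elim(3) by (intro sum_mono) auto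
      also have "\<dots> \<le> (\<Sum>i\<in>I. \<Sum>j\<in>I. \<eta> * (p i x + p j x))"
        using I \<eta> p0 by (intro sum_mono sum_mono2) (auto intro!: mult_nonneg_nonneg add_nonneg_nonneg)
      also have "\<dots> = \<eta> * (2 * real (card I)) * (\<Sum>i\<in>I. p i x)"
        by (simp add: sum.distrib sum_distrib_left[symmetric] algebra_simps)
      also have "\<dots> \<le> \<eta> * (2 * N) * (\<Sum>i\<in>I. p i x)"
        using \<eta> N p0 by (intro mult_right_mono mult_left_mono sum_nonneg) auto
      also have "\<dots> = (e / 2) * (m * (\<Sum>i\<in>I. p i x))" using N by (simp add: \<eta>_def)
      finally show ?thesis .
    qed
    have kx: "k * x > 0" using k elim(4) by simp
    have "(1 - e) * (\<Sum>i\<in>I. l i * p i x) \<le> \<P>(\<omega> in M. (\<Sum>i\<in>I. W i \<omega>) > x)"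
    proof -
      define E where "E i = {\<omega>\<in>space M. W i \<omega> > w * x \<and> (\<forall>j\<in>I - {i}. \<bar>W j \<omega>\<bar> \<le> k * x)}" for i
      have E [measurable]: "E i \<in> sets M" if "i \<in> I" for i
      proof -
        have "E i = {\<omega>\<in>space M. W i \<omega> > w * x} \<inter> {\<omega>\<in>space M. \<forall>j\<in>I - {i}. \<bar>W j \<omega>\<bar> \<le> k * x}"
          by (auto simp: E_def)
        also have "\<dots> \<in> sets M"
          using that I by (intro sets.Int sets.sets_Collect_finite_All) auto
        finally show ?thesis .
      qed
      have "k * x < w * x" using k w elim(4) by simp
      then have disj: "disjoint_family_on E I"
        unfolding disjoint_family_on_def
      proof (intro ballI impI)
        fix i j assume ij: "i \<in> I" "j \<in> I" "i \<noteq> j" and lt: "k * x < w * x"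
        show "E i \<inter> E j = {}"
        proof (intro equals0I)
          fix \<omega> assume "\<omega> \<in> E i \<inter> E j"
          then have "W i \<omega> > w * x" "\<bar>W i \<omega>\<bar> \<le> k * x" using ij by (auto simp: E_def)
          then show False using lt by linarith
        qed
      qed
      have low: "p i (w * x) - (\<Sum>j\<in>I - {i}. J j i x) \<le> measure M (E i)" if i: "i \<in> I" for i
      proof -
        have Jset: "(\<Union>j\<in>I - {i}. {\<omega>\<in>space M. \<bar>W j \<omega>\<bar> > k * x \<and> W i \<omega> > k * x}) \<in> sets M"
          by (rule sets.finite_UN) (use i I in auto)
        have "p i (w * x) \<le> measure M (E i \<union> (\<Union>j\<in>I - {i}. {\<omega>\<in>space M. \<bar>W j \<omega>\<bar> > k * x \<and> W i \<omega> > k * x}))"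
          unfolding p_def
        proof (rule finite_measure_mono)
          show "{\<omega>\<in>space M. W i \<omega> > w * x} \<subseteq> E i \<union> (\<Union>j\<in>I - {i}. {\<omega>\<in>space M. \<bar>W j \<omega>\<bar> > k * x \<and> W i \<omega> > k * x})"
            using \<open>k * x < w * x\<close> by (auto simp: E_def not_le)
        qed (intro sets.Un E i Jset)
        also have "\<dots> \<le> measure M (E i) + measure M (\<Union>j\<in>I - {i}. {\<omega>\<in>space M. \<bar>W j \<omega>\<bar> > k * x \<and> W i \<omega> > k * x})"
          by (intro measure_Un_le E i Jset)
        also have "measure M (\<Union>j\<in>I - {i}. {\<omega>\<in>space M. \<bar>W j \<omega>\<bar> > k * x \<and> W i \<omega> > k * x}) \<le> (\<Sum>j\<in>I - {i}. J j i x)"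
          unfolding J_def by (rule measure_UNION_le) (use i I in auto)
        finally show ?thesis by simp
      qed
      have swap: "(\<Sum>i\<in>I. \<Sum>j\<in>I - {i}. J j i x) = (\<Sum>i\<in>I. \<Sum>j\<in>I - {i}. J i j x)"
      proof -
        have "(\<Sum>i\<in>I. \<Sum>j\<in>I - {i}. J j i x) = (\<Sum>i\<in>I. \<Sum>j | j \<in> I \<and> i \<noteq> j. J j i x)"
          by (intro sum.cong refl) auto
        also have "\<dots> = (\<Sum>j\<in>I. \<Sum>i | i \<in> I \<and> i \<noteq> j. J j i x)"
          by (rule sum.swap_restrict) (use I in auto)
        also have "\<dots> = (\<Sum>i\<in>I. \<Sum>j\<in>I - {i}. J i j x)"
          by (intro sum.cong refl) auto
        finally show ?thesis .
      qed
      have "(1 - e / 2) * l i \<le> s i" if "i \<in> I" for i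
      proof -
        have "(1 - e / 2) * (1 + e / 2) \<le> 1" by (simp add: algebra_simps)
        then have "(1 - e / 2) * (1 + e / 2) * l i \<le> 1 * l i" using l(1)[OF that] by (intro mult_right_mono) auto
        then show ?thesis using e by (simp add: s_def pos_le_divide_eq mult_ac)
      qed
      then have "(1 - e / 2) * (\<Sum>i\<in>I. l i * p i x) \<le> (\<Sum>i\<in>I. s i * p i x)"
        unfolding sum_distrib_left mult.assoc[symmetric] using p0 by (intro sum_mono mult_right_mono) auto
      also have "\<dots> \<le> (\<Sum>i\<in>I. p i (w * x))" using elim(1) by (intro sum_mono) auto
      finally have 1: "(1 - e / 2) * (\<Sum>i\<in>I. l i * p i x) \<le> (\<Sum>i\<in>I. p i (w * x))" .
      have "(\<Sum>i\<in>I. p i (w * x)) - (\<Sum>i\<in>I. \<Sum>j\<in>I - {i}. J j i x) \<le> (\<Sum>i\<in>I. measure M (E i))"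
        unfolding sum_subtractf[symmetric] by (intro sum_mono low)
      also have "\<dots> = measure M (\<Union>i\<in>I. E i)"
        using I disj E by (intro finite_measure_finite_Union[symmetric]) auto
      also have "\<dots> \<le> \<P>(\<omega> in M. (\<Sum>i\<in>I. W i \<omega>) > x)"
      proof (rule finite_measure_mono)
        show "(\<Union>i\<in>I. E i) \<subseteq> {\<omega>\<in>space M. (\<Sum>i\<in>I. W i \<omega>) > x}"
        proof safe
          fix i \<omega> assume i: "i \<in> I" and \<omega>: "\<omega> \<in> E i"
          show "\<omega> \<in> space M" using \<omega> by (simp add: E_def)
          have "- (N * (k * x)) \<le> - (real (card (I - {i})) * (k * x))"
          proof -
            have "card (I - {i}) \<le> card I" using I by (intro card_mono) auto
            then have "real (card (I - {i})) \<le> N" using N by linarith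
            then show ?thesis using mult_right_mono[of "real (card (I - {i}))" N "k * x"] kx by simp
          qed
          also have "\<dots> = (\<Sum>j\<in>I - {i}. - (k * x))" by simp
          also have "\<dots> \<le> (\<Sum>j\<in>I - {i}. W j \<omega>)"
            using \<omega> by (intro sum_mono) (auto simp: E_def abs_le_iff minus_le_iff)
          finally have "- (d * x) \<le> (\<Sum>j\<in>I - {i}. W j \<omega>)" using k(3) by (simp add: mult.assoc[symmetric])
          moreover have "d * x < (w - 1) * x" using d(3) elim(4) by simp
          moreover have "(\<Sum>i\<in>I. W i \<omega>) = W i \<omega> + (\<Sum>j\<in>I - {i}. W j \<omega>)" using I i by (rule sum.remove)
          moreover have "W i \<omega> > w * x" using \<omega> by (simp add: E_def)
          ultimately show "x < (\<Sum>i\<in>I. W i \<omega>)" by (simp add: algebra_simps)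
        qed
      qed simp
      finally have 2: "(\<Sum>i\<in>I. p i (w * x)) - (\<Sum>i\<in>I. \<Sum>j\<in>I - {i}. J i j x) \<le> \<P>(\<omega> in M. (\<Sum>i\<in>I. W i \<omega>) > x)"
        unfolding swap .
      have "m * (\<Sum>i\<in>I. p i x) \<le> (\<Sum>i\<in>I. l i * p i x)"
        unfolding sum_distrib_left using m p0 by (intro sum_mono mult_right_mono) auto
      then have "(e / 2) * (m * (\<Sum>i\<in>I. p i x)) \<le> (e / 2) * (\<Sum>i\<in>I. l i * p i x)"
        using e by (intro mult_left_mono) auto
      with 1 2 sumJ show ?thesis by (simp add: algebra_simps)
    qed
    moreover have "\<P>(\<omega> in M. (\<Sum>i\<in>I. W i \<omega>) > x) \<le> (1 + e) * (\<Sum>i\<in>I. (1 / l i) * p i x)"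
    proof -
      let ?Z = "\<Sum>i\<in>I. (1 / l i) * p i x"
      let ?A = "\<lambda>i. {\<omega>\<in>space M. W i \<omega> > x / w}"
      let ?B = "\<lambda>i j. {\<omega>\<in>space M. \<bar>W i \<omega>\<bar> > k * x \<and> W j \<omega> > k * x}"
      have A: "(\<Union>i\<in>I. ?A i) \<in> sets M" by (rule sets.finite_UN) (use I in auto)
      have B1: "(\<Union>j\<in>I - {i}. ?B i j) \<in> sets M" if "i \<in> I" for i
        by (rule sets.finite_UN) (use I that in auto)
      have B: "(\<Union>i\<in>I. \<Union>j\<in>I - {i}. ?B i j) \<in> sets M"
        by (rule sets.finite_UN) (use I B1 in auto)
      have "\<P>(\<omega> in M. (\<Sum>i\<in>I. W i \<omega>) > x) \<le> measure M ((\<Union>i\<in>I. ?A i) \<union> (\<Union>i\<in>I. \<Union>j\<in>I - {i}. ?B i j))"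
      proof (rule finite_measure_mono)
        show "{\<omega>\<in>space M. (\<Sum>i\<in>I. W i \<omega>) > x} \<subseteq> (\<Union>i\<in>I. ?A i) \<union> (\<Union>i\<in>I. \<Union>j\<in>I - {i}. ?B i j)"
        proof
          fix \<omega> assume "\<omega> \<in> {\<omega>\<in>space M. (\<Sum>i\<in>I. W i \<omega>) > x}"
          then have \<omega>: "\<omega> \<in> space M" "(\<Sum>i\<in>I. W i \<omega>) > x" by auto
          show "\<omega> \<in> (\<Union>i\<in>I. ?A i) \<union> (\<Union>i\<in>I. \<Union>j\<in>I - {i}. ?B i j)"
          proof (cases "\<exists>i\<in>I. W i \<omega> > x / w")
            case True
            then show ?thesis using \<omega>(1) by auto
          next
            case False
            obtain j where j: "j \<in> I" "W j \<omega> > x / N"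
              using exists_summand_gt[OF I N(2) _ _ \<omega>(2)] N elim(4) by auto
            have "W j \<omega> \<le> x / w" using False j(1) by auto
            moreover have "(\<Sum>i\<in>I. W i \<omega>) = W j \<omega> + (\<Sum>i\<in>I - {j}. W i \<omega>)" using I j(1) by (rule sum.remove)
            moreover have "d * x = x - x / w" by (simp add: d_def algebra_simps)
            ultimately have gt: "(\<Sum>i\<in>I - {j}. W i \<omega>) > d * x" using \<omega>(2) by linarith
            have "card (I - {j}) \<le> card I" using I by (intro card_mono) auto
            then have "real (card (I - {j})) \<le> N" using N by linarith
            then obtain i where i: "i \<in> I - {j}" "W i \<omega> > d * x / N"
              using exists_summand_gt[OF _ _ _ _ gt, of N] I N d elim(4) by auto
            have "W i \<omega> > k * x" using i(2) by (simp add: k_def)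
            moreover have "W j \<omega> > k * x"
              using j(2) mult_right_mono[OF k(4), of x] elim(4) by simp
            ultimately show ?thesis using i(1) j(1) \<omega>(1) kx by force
          qed
        qed
        show "(\<Union>i\<in>I. ?A i) \<union> (\<Union>i\<in>I. \<Union>j\<in>I - {i}. ?B i j) \<in> sets M" using A B by (rule sets.Un)
      qed
      also have "\<dots> \<le> measure M (\<Union>i\<in>I. ?A i) + measure M (\<Union>i\<in>I. \<Union>j\<in>I - {i}. ?B i j)"
        using A B by (rule measure_Un_le)
      also have "\<dots> \<le> (1 + e / 2) * ?Z + e / 2 * ?Z"
      proof (rule add_mono)
        have "measure M (\<Union>i\<in>I. ?A i) \<le> (\<Sum>i\<in>I. p i (x / w))"
          unfolding p_def by (rule measure_UNION_le) (use I in auto)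
        also have "\<dots> \<le> (1 + e / 2) * ?Z"
          unfolding sum_distrib_left
        proof (rule sum_mono)
          fix i assume i: "i \<in> I"
          have "s i * p i (x / w) \<le> p i x" using elim(2) i by blast
          then show "p i (x / w) \<le> (1 + e / 2) * ((1 / l i) * p i x)"
            using l(1)[OF i] e by (simp add: s_def field_simps)
        qed
        finally show "measure M (\<Union>i\<in>I. ?A i) \<le> (1 + e / 2) * ?Z" .
        have "measure M (\<Union>i\<in>I. \<Union>j\<in>I - {i}. ?B i j) \<le> (\<Sum>i\<in>I. measure M (\<Union>j\<in>I - {i}. ?B i j))"
          by (rule measure_UNION_le) (use I B1 in auto)
        also have "\<dots> \<le> (\<Sum>i\<in>I. \<Sum>j\<in>I - {i}. J i j x)"
          unfolding J_def by (intro sum_mono measure_UNION_le) (use I in auto)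
        also note sumJ
        also have "e / 2 * (m * (\<Sum>i\<in>I. p i x)) \<le> e / 2 * ?Z"
        proof (rule mult_left_mono)
          show "m * (\<Sum>i\<in>I. p i x) \<le> ?Z"
            unfolding sum_distrib_left
          proof (intro sum_mono mult_right_mono p0)
            fix i assume i: "i \<in> I"
            have "1 \<le> 1 / l i" using l[OF i] by simp
            then show "m \<le> 1 / l i" using m(2) by linarith
          qed
        qed (use e in simp)
        finally show "measure M (\<Union>i\<in>I. \<Union>j\<in>I - {i}. ?B i j) \<le> e / 2 * ?Z" .
      qed
      also have "\<dots> = (1 + e) * ?Z" by (simp add: distrib_right)
      finally show ?thesis .
    qed
    ultimately show ?case by (simp add: p_def)
  qed
qed

section \<open>From tail probabilities to truncated expectations\<close>

lemma nn_integral_tail_formula: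
  assumes M: "sigma_finite_measure M" and [measurable]: "f \<in> borel_measurable M"
    and nn: "\<And>\<omega>. f \<omega> \<ge> 0"
  shows "(\<integral>\<^sup>+\<omega>. ennreal (f \<omega>) \<partial>M)
    = (\<integral>\<^sup>+t. emeasure M {\<omega>\<in>space M. f \<omega> > t} * indicator {0..} t \<partial>lborel)"
proof -
  interpret M: sigma_finite_measure M by fact
  interpret P: pair_sigma_finite M lborel ..
  define g where "g = (\<lambda>(\<omega>, t). indicator {p \<in> space (M \<Otimes>\<^sub>M lborel). 0 \<le> snd p \<and> snd p < f (fst p)} (\<omega>, t) :: ennreal)"
  have [measurable]: "g \<in> borel_measurable (M \<Otimes>\<^sub>M lborel)" unfolding g_def by measurable
  have "(\<integral>\<^sup>+\<omega>. ennreal (f \<omega>) \<partial>M) = (\<integral>\<^sup>+\<omega>. \<integral>\<^sup>+t. g (\<omega>, t) \<partial>lborel \<partial>M)"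
  proof (rule nn_integral_cong)
    fix \<omega> assume \<omega>: "\<omega> \<in> space M"
    have "(\<integral>\<^sup>+t. g (\<omega>, t) \<partial>lborel) = (\<integral>\<^sup>+t. indicator {0..<f \<omega>} t \<partial>lborel)"
      using \<omega> by (intro nn_integral_cong) (auto simp: g_def indicator_def space_pair_measure)
    then show "ennreal (f \<omega>) = (\<integral>\<^sup>+t. g (\<omega>, t) \<partial>lborel)" using nn[of \<omega>] by simp
  qed
  also have "\<dots> = (\<integral>\<^sup>+t. \<integral>\<^sup>+\<omega>. g (\<omega>, t) \<partial>M \<partial>lborel)"
    by (rule P.Fubini'[symmetric]) simp
  also have "\<dots> = (\<integral>\<^sup>+t. emeasure M {\<omega>\<in>space M. f \<omega> > t} * indicator {0..} t \<partial>lborel)"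
  proof (rule nn_integral_cong)
    fix t :: real
    have "(\<integral>\<^sup>+\<omega>. g (\<omega>, t) \<partial>M) = (\<integral>\<^sup>+\<omega>. indicator {0..} t * indicator {\<omega>\<in>space M. f \<omega> > t} \<omega> \<partial>M)"
      by (intro nn_integral_cong) (auto simp: g_def indicator_def space_pair_measure)
    also have "\<dots> = indicator {0..} t * emeasure M {\<omega>\<in>space M. f \<omega> > t}"
      by (rule nn_integral_cmult_indicator) measurable
    finally show "(\<integral>\<^sup>+\<omega>. g (\<omega>, t) \<partial>M) = emeasure M {\<omega>\<in>space M. f \<omega> > t} * indicator {0..} t"
      by (simp add: mult.commute)
  qed
  finally show ?thesis .
qed

text \<open>
  For \<open>t \<ge> 0\<close> the set of all \<open>u\<close> with \<open>\<phi>(u) 1{u > x} > t\<close> is upward closed, open by continuity of \<open>\<phi>\<close>, and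
  contained in \<open>(x, \<infinity>)\<close>; hence it is empty or an open half-line to which \<open>le\<close> applies.
\<close>

lemma tail_expectation_mono:
  fixes V :: "'i \<Rightarrow> 'a \<Rightarrow> real" and W :: "'j \<Rightarrow> 'a \<Rightarrow> real"
  assumes M: "prob_space M" and fin: "finite A" "finite B"
    and V: "\<And>i. i \<in> A \<Longrightarrow> V i \<in> borel_measurable M" and W: "\<And>j. j \<in> B \<Longrightarrow> W j \<in> borel_measurable M"
    and \<alpha>: "\<And>i. i \<in> A \<Longrightarrow> \<alpha> i \<ge> 0" and \<beta>: "\<And>j. j \<in> B \<Longrightarrow> \<beta> j \<ge> 0"
    and le: "\<And>y. y \<ge> x \<Longrightarrow> (\<Sum>i\<in>A. \<alpha> i * \<P>(\<omega> in M. V i \<omega> > y)) \<le> (\<Sum>j\<in>B. \<beta> j * \<P>(\<omega> in M. W j \<omega> > y))"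
    and \<phi>: "\<And>u. \<phi> u \<ge> 0" "mono_on {x<..} \<phi>" "continuous_on {x<..} \<phi>"
  shows "(\<Sum>i\<in>A. ennreal (\<alpha> i) * tail_expectation M \<phi> (V i) x)
    \<le> (\<Sum>j\<in>B. ennreal (\<beta> j) * tail_expectation M \<phi> (W j) x)"
proof -
  interpret prob_space M by fact
  define f where "f u = \<phi> u * indicator {x<..} u" for u
  have f_meas [measurable]: "f \<in> borel_measurable borel"
    using borel_measurable_continuous_on_indicator[OF _ \<phi>(3)]
    by (simp add: f_def[abs_def] mult.commute)
  have f0: "f u \<ge> 0" for u using \<phi>(1) by (simp add: f_def)
  define H where "H Y t = emeasure M {\<omega>\<in>space M. f (Y \<omega>) > t} * indicator {0..} t" for Y and t :: real
  have H_meas: "H Y \<in> borel_measurable borel" if [measurable]: "Y \<in> borel_measurable M" for Y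
  proof -
    have "{p\<in>space (lborel \<Otimes>\<^sub>M M). f (Y (snd p)) > fst p} \<in> sets (lborel \<Otimes>\<^sub>M M)" by measurable
    from measurable_emeasure_Pair[OF this]
    have "(\<lambda>t. emeasure M {\<omega>\<in>space M. f (Y \<omega>) > t}) \<in> borel_measurable lborel"
      by (simp add: vimage_def space_pair_measure)
    then show ?thesis unfolding H_def[abs_def] by measurable
  qed
  have te: "tail_expectation M \<phi> Y x = (\<integral>\<^sup>+t. H Y t \<partial>lborel)" if [measurable]: "Y \<in> borel_measurable M" for Y
  proof -
    have "tail_expectation M \<phi> Y x = (\<integral>\<^sup>+\<omega>. ennreal (f (Y \<omega>)) \<partial>M)"
      unfolding tail_expectation_def by (intro nn_integral_cong) (auto simp: f_def indicator_def)
    then show ?thesis unfolding H_def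
      by (subst (asm) nn_integral_tail_formula) (use f0 sigma_finite_measure_axioms in auto)
  qed
  have upset: "{u. f u > t} = {} \<or> (\<exists>a\<ge>x. {u. f u > t} = {a<..})" if t: "t \<ge> 0" for t
  proof (cases "{u. f u > t} = {}")
    case False
    let ?U = "{u. f u > t}"
    have U: "?U = \<phi> -` {t<..} \<inter> {x<..}" using t by (auto simp: f_def indicator_def split: if_splits)
    have op: "open ?U" unfolding U using \<phi>(3) by (subst (asm) continuous_on_open_vimage) auto
    have bdd: "bdd_below ?U" unfolding U by (intro bdd_belowI[of _ x]) auto
    have up: "v \<in> ?U" if "u \<in> ?U" "u \<le> v" for u v
      using that mono_onD[OF \<phi>(2), of u v] unfolding U by auto
    have "Inf ?U \<ge> x" using False unfolding U by (intro cInf_greatest) auto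
    moreover have "?U = {Inf ?U<..}"
    proof (intro equalityI subsetI)
      fix u assume u: "u \<in> ?U"
      obtain \<delta> where \<delta>: "\<delta> > 0" "ball u \<delta> \<subseteq> ?U" using op u open_contains_ball by blast
      then have "u - \<delta> / 2 \<in> ?U" by (auto simp: dist_real_def subset_eq)
      then have "Inf ?U \<le> u - \<delta> / 2" using bdd by (rule cInf_lower)
      then show "u \<in> {Inf ?U<..}" using \<delta>(1) by simp
    next
      fix u assume "u \<in> {Inf ?U<..}"
      then obtain v where "v \<in> ?U" "v < u" using cInf_lessD[OF False] by auto
      then show "u \<in> ?U" using up by simp
    qed
    ultimately show ?thesis by blast
  qed simp
  have "(\<Sum>i\<in>A. ennreal (\<alpha> i) * H (V i) t) \<le> (\<Sum>j\<in>B. ennreal (\<beta> j) * H (W j) t)" for t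
  proof (cases "t \<ge> 0")
    case True
    have HP: "ennreal c * H Y t = ennreal (c * \<P>(\<omega> in M. Y \<omega> \<in> {u. f u > t}))" if "c \<ge> 0" for c Y
      using True that by (simp add: H_def emeasure_eq_measure ennreal_mult)
    have "(\<Sum>i\<in>A. \<alpha> i * \<P>(\<omega> in M. V i \<omega> \<in> {u. f u > t})) \<le> (\<Sum>j\<in>B. \<beta> j * \<P>(\<omega> in M. W j \<omega> \<in> {u. f u > t}))"
      using upset[OF True]
    proof
      assume "\<exists>a\<ge>x. {u. f u > t} = {a<..}"
      then obtain a where "a \<ge> x" and eq: "{u. f u > t} = {a<..}" by blast
      then show ?thesis using le[of a] unfolding eq by simp
    qed simp
    then show ?thesis using \<alpha> \<beta> by (simp add: HP sum_ennreal ennreal_leI cong: sum.cong)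
  qed (simp add: H_def)
  then have "(\<integral>\<^sup>+t. (\<Sum>i\<in>A. ennreal (\<alpha> i) * H (V i) t) \<partial>lborel) \<le> (\<integral>\<^sup>+t. (\<Sum>j\<in>B. ennreal (\<beta> j) * H (W j) t) \<partial>lborel)"
    by (intro nn_integral_mono)
  moreover have "(\<integral>\<^sup>+t. (\<Sum>i\<in>C. ennreal (c i) * H (Y i) t) \<partial>lborel)
      = (\<Sum>i\<in>C. ennreal (c i) * tail_expectation M \<phi> (Y i) x)"
    if "\<And>i. i \<in> C \<Longrightarrow> Y i \<in> borel_measurable M" for C :: "'k set" and c and Y :: "'k \<Rightarrow> 'a \<Rightarrow> real"
    using that
    by (subst nn_integral_sum) (auto intro!: sum.cong borel_measurable_times_ennreal simp: te nn_integral_cmult H_meas)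
  note this[of A V \<alpha>, OF V] this[of B W \<beta>, OF W]
  ultimately show ?thesis by simp
qed

section \<open>Randomly weighted sums\<close>

lemma asym_leI:
  assumes "\<And>c::real. c > 1 \<Longrightarrow> \<forall>\<^sub>F x in \<F>. f x \<le> ennreal c * g x"
  shows "asym_le \<F> f g"
  unfolding asym_le_def Limsup_le_iff
proof (intro allI impI)
  fix y :: ennreal assume "y > 1"
  then obtain z where z: "1 < z" "z < y" using dense by blast
  then obtain c where c: "z = ennreal c" "c \<ge> 0" by (cases z) auto
  have "c > 1" using z(1) c by (simp add: ennreal_less_iff flip: ennreal_1)
  from assms[OF this] show "\<forall>\<^sub>F x in \<F>. f x / g x < y"
  proof eventually_elim
    case (elim x)
    have "f x / g x \<le> ennreal c"
    proof (cases "g x = 0")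
      case True
      then show ?thesis using elim by simp
    next
      case False
      then show ?thesis using elim by (intro divide_le_posI_ennreal) (auto simp: mult.commute zero_less_iff_neq_zero)
    qed
    then show ?case using z(2) c(1) by simp
  qed
qed

text \<open>
  The theorem for tail probabilities.  A single weight need not be bounded, because the tail
  condition on the weights says nothing without a second index; for \<open>n = 1\<close> the bounds follow
  from \<open>l\<^sub>1 \<le> 1\<close> alone.
\<close>

lemma tail_of_weighted_sum:
  fixes X \<Theta> :: "nat \<Rightarrow> 'a \<Rightarrow> real"
    and F b h :: "nat \<Rightarrow> real \<Rightarrow> real" and l :: "nat \<Rightarrow> real"
  assumes M: "prob_space M"
    and X_rv: "\<forall>i\<in>{1..n}. X i \<in> borel_measurable M"
    and F: "\<forall>i\<in>{1..n}. F i = cdf (distr M borel (X i))"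
    and F_pos: "\<forall>i\<in>{1..n}. \<forall>x\<ge>0. survival (F i) x > 0"
    and F_D: "\<forall>i\<in>{1..n}. dominatedly_varying (F i)"
    and qai: "pQAI M {1..n} X"
    and \<Theta>_rv: "\<forall>i\<in>{1..n}. \<Theta> i \<in> borel_measurable M"
    and \<Theta>_nonneg: "\<forall>i\<in>{1..n}. AE \<omega> in M. \<Theta> i \<omega> \<ge> 0"
    and \<Theta>_nondegenerate: "\<forall>i\<in>{1..n}. \<not> (AE \<omega> in M. \<Theta> i \<omega> = 0)"
    and \<Theta>_tail: "\<forall>i\<in>{1..n}. \<forall>j\<in>{1..n}. i \<noteq> j \<longrightarrow>
      (\<lambda>(x, y). \<P>(\<omega> in M. \<Theta> i \<omega> > b i x))
        \<in> o[min_at_top](\<lambda>(x, y). \<P>(\<omega> in M. \<Theta> i \<omega> * X i \<omega> > x \<and> \<Theta> j \<omega> * X j \<omega> > y))"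
    and h_pos: "\<forall>i\<in>{1..n}. \<forall>\<theta>\<ge>0. h i \<theta> > 0"
    and ex: "\<forall>i\<in>{1..n}. \<forall>\<^sub>F x in at_top. \<forall>\<theta>\<in>rv_support M (\<Theta> i).
      has_cond_prob M (\<lambda>\<omega>. X i \<omega> > x) (near1 (\<Theta> i) \<theta>)"
    and equiv: "\<forall>i\<in>{1..n}. unif_asym_equiv (rv_support M (\<Theta> i)) at_top
      (\<lambda>x \<theta>. cond_prob_at M (\<lambda>\<omega>. X i \<omega> > x) (near1 (\<Theta> i) \<theta>))
      (\<lambda>x \<theta>. h i \<theta> * \<P>(\<omega> in M. X i \<omega> > x))"
    and l: "\<forall>i\<in>{1..n}. L_index (F i) = ennreal (l i) \<and> 0 < l i"
    and e: "e > 0"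
  shows "\<forall>\<^sub>F x in at_top.
      (1 - e) * (\<Sum>i=1..n. l i * \<P>(\<omega> in M. \<Theta> i \<omega> * X i \<omega> > x))
        \<le> \<P>(\<omega> in M. (\<Sum>i=1..n. \<Theta> i \<omega> * X i \<omega>) > x) \<and>
      \<P>(\<omega> in M. (\<Sum>i=1..n. \<Theta> i \<omega> * X i \<omega>) > x)
        \<le> (1 + e) * (\<Sum>i=1..n. (1 / l i) * \<P>(\<omega> in M. \<Theta> i \<omega> * X i \<omega> > x))"
proof -
  interpret prob_space M by fact
  have surv: "survival (F i) x = \<P>(\<omega> in M. X i \<omega> > x)" if "i \<in> {1..n}" for i x
    using F X_rv that M by (simp add: survival_eq_prob)
  have anti: "antimono (survival (F i))" if i: "i \<in> {1..n}" for i
  proof (rule antimonoI)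
    have [measurable]: "X i \<in> borel_measurable M" using X_rv i by blast
    fix x y :: real assume "x \<le> y"
    then show "survival (F i) y \<le> survival (F i) x"
      unfolding surv[OF i] by (intro finite_measure_mono) auto
  qed
  have pos: "\<P>(\<omega> in M. X i \<omega> > x) > 0" if "i \<in> {1..n}" "x \<ge> 0" for i x
    using F_pos that surv by metis
  have dom: "\<exists>C>0. \<forall>\<^sub>F x in at_top. \<P>(\<omega> in M. X i \<omega> > c * x) \<le> C * \<P>(\<omega> in M. X i \<omega> > x)"
    if i: "i \<in> {1..n}" and c: "c > 0" for i c
    by (rule dominatedly_varying_bound[of "F i" c]) (use F_D F_pos anti i c surv in auto)
  have L: "l i \<le> 1 \<and> (\<forall>s. 0 \<le> s \<longrightarrow> s < l i \<longrightarrow>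
      (\<exists>v>1. \<forall>\<^sub>F x in at_top. s * \<P>(\<omega> in M. X i \<omega> > x) \<le> \<P>(\<omega> in M. X i \<omega> > v * x)))"
    if i: "i \<in> {1..n}" for i
  proof -
    obtain l' where l': "L_index (F i) = ennreal l'" "0 < l'" "l' \<le> 1"
      "\<And>s. 0 \<le> s \<Longrightarrow> s < l' \<Longrightarrow> \<exists>v>1. \<forall>\<^sub>F x in at_top. s * survival (F i) x \<le> survival (F i) (v * x)"
      by (rule L_index_properties[of "F i"]) (use F_D F_pos anti i in auto)
    have "L_index (F i) = ennreal (l i)" "0 < l i" using l i by blast+
    then have "l' = l i" using l'(1,2) by (simp add: ennreal_inj)
    then show ?thesis using l'(3,4) unfolding surv[OF i] by blast
  qed
  show ?thesis
  proof (cases "n \<le> 1")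
    case True
    have "(1 - e) * (l 1 * p) \<le> p \<and> p \<le> (1 + e) * ((1 / l 1) * p)" if "n = 1" "p \<ge> 0" for p
    proof
      have l1: "0 < l 1" "l 1 \<le> 1" using l L[of 1] that by auto
      have "(1 - e) * l 1 \<le> 1 * 1" using l1 e by (intro mult_mono) auto
      then show "(1 - e) * (l 1 * p) \<le> p" using mult_right_mono[OF _ that(2), of "(1 - e) * l 1" 1] by (simp add: mult.assoc)
      have "1 * 1 \<le> (1 + e) * (1 / l 1)" using l1 e by (intro mult_mono) auto
      then show "p \<le> (1 + e) * ((1 / l 1) * p)"
        using mult_right_mono[OF _ that(2), of 1 "(1 + e) * (1 / l 1)"] by (simp add: mult.assoc)
    qed
    moreover have "n = 0 \<or> n = 1" using True by auto
    ultimately have n: "n = 0 \<or> n = 1 \<and> (\<forall>p\<ge>0. (1 - e) * (l 1 * p) \<le> p \<and> p \<le> (1 + e) * ((1 / l 1) * p))"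
      by blast
    show ?thesis
      using eventually_ge_at_top[of "0::real"]
    proof eventually_elim
      case (elim x)
      from n show ?case
      proof
        assume "n = 0"
        then show ?thesis using elim by (simp add: not_less[symmetric])
      qed simp
    qed
  next
    case False
    have bdd: "\<exists>K. AE \<omega> in M. 0 \<le> \<Theta> i \<omega> \<and> \<Theta> i \<omega> \<le> K" if i: "i \<in> {1..n}" for i
    proof -
      define j where "j = (if i = 1 then 2 else 1::nat)"
      have j: "j \<in> {1..n}" "i \<noteq> j" using False by (auto simp: j_def)
      have [measurable]: "X i \<in> borel_measurable M" "X j \<in> borel_measurable M"
        "\<Theta> i \<in> borel_measurable M" "\<Theta> j \<in> borel_measurable M" using X_rv \<Theta>_rv i j by auto
      obtain K where "AE \<omega> in M. \<Theta> i \<omega> \<le> K"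
        using weight_bounded[OF M, of "\<Theta> i" "\<lambda>\<omega>. \<Theta> i \<omega> * X i \<omega>" "\<lambda>\<omega>. \<Theta> j \<omega> * X j \<omega>" "b i"] \<Theta>_tail i j
        by auto
      moreover have "AE \<omega> in M. \<Theta> i \<omega> \<ge> 0" using \<Theta>_nonneg i by blast
      ultimately show ?thesis by auto
    qed
    show ?thesis
    proof (rule tail_of_sum[OF M])
      show "(\<lambda>\<omega>. \<Theta> i \<omega> * X i \<omega>) \<in> borel_measurable M" if "i \<in> {1..n}" for i
        using X_rv \<Theta>_rv that by (intro borel_measurable_times) auto
      show "0 < l i" "l i \<le> 1" if "i \<in> {1..n}" for i using l L that by auto
    next
      fix i and s :: real assume i: "i \<in> {1..n}" and s: "0 < s" "s < l i"
      \<comment> \<open>an intermediate constant leaves room for the relative error \<open>1 - s / a\<close>\<close>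
      define a where "a = (s + l i) / 2"
      have a: "0 < a" "s < a" "a < l i" using s by (auto simp: a_def)
      obtain v where v: "v > 1" "\<forall>\<^sub>F x in at_top. a * \<P>(\<omega> in M. X i \<omega> > x) \<le> \<P>(\<omega> in M. X i \<omega> > v * x)"
        using L[OF i] less_imp_le[OF a(1)] a(3) by blast
      obtain K where K: "AE \<omega> in M. 0 \<le> \<Theta> i \<omega> \<and> \<Theta> i \<omega> \<le> K" using bdd[OF i] by blast
      have "\<exists>w>1. \<forall>\<^sub>F x in at_top. (1 - (1 - s / a)) * a * \<P>(\<omega> in M. \<Theta> i \<omega> * X i \<omega> > x)
          \<le> \<P>(\<omega> in M. \<Theta> i \<omega> * X i \<omega> > w * x)"
        by (rule tail_ratio_of_product[OF M _ _ K _ _ _ pos[OF i] _ _ v(1) _ v(2), where h = "h i"])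
          (use X_rv \<Theta>_rv equiv ex h_pos i s a in auto)
      then show "\<exists>w>1. \<forall>\<^sub>F x in at_top. s * \<P>(\<omega> in M. \<Theta> i \<omega> * X i \<omega> > x)
          \<le> \<P>(\<omega> in M. \<Theta> i \<omega> * X i \<omega> > w * x)"
        using a by simp
    next
      fix i j and k \<eta> :: real
      assume ij: "i \<in> {1..n}" "j \<in> {1..n}" "i \<noteq> j" and k: "k > 0" "\<eta> > 0"
      obtain K K' where K: "AE \<omega> in M. 0 \<le> \<Theta> i \<omega> \<and> \<Theta> i \<omega> \<le> K" "AE \<omega> in M. 0 \<le> \<Theta> j \<omega> \<and> \<Theta> j \<omega> \<le> K'"
        using bdd ij by blast
      have low: "\<exists>c>0. \<forall>\<^sub>F x in at_top. c * \<P>(\<omega> in M. X i \<omega> > x) \<le> \<P>(\<omega> in M. \<Theta> i \<omega> * X i \<omega> > x)"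
        if i: "i \<in> {1..n}" for i
        by (rule tail_of_product_lower_bound[OF M _ _ _ _ _ _ _ pos[OF i] dom[OF i], where h = "h i"])
          (use X_rv \<Theta>_rv \<Theta>_nonneg \<Theta>_nondegenerate equiv ex h_pos i in auto)
      show "\<forall>\<^sub>F x in at_top. \<P>(\<omega> in M. \<bar>\<Theta> i \<omega> * X i \<omega>\<bar> > k * x \<and> \<Theta> j \<omega> * X j \<omega> > k * x)
        \<le> \<eta> * (\<P>(\<omega> in M. \<Theta> i \<omega> * X i \<omega> > x) + \<P>(\<omega> in M. \<Theta> j \<omega> * X j \<omega> > x))"
        by (rule joint_tail_of_products[OF M _ _ _ _ K _ _ pos[OF ij(1)] dom[OF ij(1)] dom[OF ij(2)]
              low[OF ij(1)] low[OF ij(2)] k])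
          (use X_rv \<Theta>_rv qai ij in \<open>auto simp: pQAI_def\<close>)
    qed (use e in auto)
  qed
qed


theorem theorem4p1:
  fixes M :: "'a measure" and n :: nat
    and X \<Theta> :: "nat \<Rightarrow> 'a \<Rightarrow> real"
    and F b h :: "nat \<Rightarrow> real \<Rightarrow> real"
    and g :: "nat \<Rightarrow> nat \<Rightarrow> real \<times> real \<Rightarrow> real"
    and L U :: real
    and \<phi> :: "real \<Rightarrow> real"
  assumes prob: "prob_space M"
    and X_rv: "\<forall>i\<in>{1..n}. X i \<in> borel_measurable M"
    and F_distribution: "\<forall>i\<in>{1..n}. F i = cdf (distr M borel (X i))"
    and F_tail_pos: "\<forall>i\<in>{1..n}. \<forall>x\<ge>0. survival (F i) x > 0"
    and F_D: "\<forall>i\<in>{1..n}. dominatedly_varying (F i)"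
    and X_pQAI: "pQAI M {1..n} X"
    and \<Theta>_rv: "\<forall>i\<in>{1..n}. \<Theta> i \<in> borel_measurable M"
    and \<Theta>_nonneg: "\<forall>i\<in>{1..n}. AE \<omega> in M. \<Theta> i \<omega> \<ge> 0"
    and \<Theta>_nondegenerate: "\<forall>i\<in>{1..n}. \<not> (AE \<omega> in M. \<Theta> i \<omega> = 0)"
    \<comment> \<open>(i)\<close>
    and b_pos: "\<forall>i\<in>{1..n}. \<forall>x\<ge>0. b i x > 0"
    and b_at_top: "\<forall>i\<in>{1..n}. filterlim (b i) at_top at_top"
    and b_sublinear: "\<forall>i\<in>{1..n}. ((\<lambda>x. b i x / x) \<longlongrightarrow> 0) at_top"
    and \<Theta>_tail: "\<forall>i\<in>{1..n}. \<forall>j\<in>{1..n}. i \<noteq> j \<longrightarrow>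
      (\<lambda>(x\<^sub>i, x\<^sub>j). \<P>(\<omega> in M. \<Theta> i \<omega> > b i x\<^sub>i))
        \<in> o[min_at_top](\<lambda>(x\<^sub>i, x\<^sub>j). \<P>(\<omega> in M. \<Theta> i \<omega> * X i \<omega> > x\<^sub>i \<and> \<Theta> j \<omega> * X j \<omega> > x\<^sub>j))"
    \<comment> \<open>(ii)\<close>
    and h_pos: "\<forall>i\<in>{1..n}. \<forall>\<theta>\<ge>0. h i \<theta> > 0"
    and cond1_exists: "\<forall>i\<in>{1..n}. \<forall>\<^sub>F x in at_top. \<forall>\<theta>\<in>rv_support M (\<Theta> i).
      has_cond_prob M (\<lambda>\<omega>. X i \<omega> > x) (near1 (\<Theta> i) \<theta>)"
    and cond1_equiv: "\<forall>i\<in>{1..n}. unif_asym_equiv (rv_support M (\<Theta> i)) at_top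
      (\<lambda>x \<theta>. cond_prob_at M (\<lambda>\<omega>. X i \<omega> > x) (near1 (\<Theta> i) \<theta>))
      (\<lambda>x \<theta>. h i \<theta> * \<P>(\<omega> in M. X i \<omega> > x))"
    \<comment> \<open>(iii)\<close>
    and g_measurable: "\<forall>i\<in>{1..n}. \<forall>j\<in>{1..n}. i \<noteq> j \<longrightarrow>
      g i j \<in> borel_measurable (restrict_space borel ({0..} \<times> {0..}))"
    and g_pos: "\<forall>i\<in>{1..n}. \<forall>j\<in>{1..n}. i \<noteq> j \<longrightarrow> (\<forall>p\<in>{0..} \<times> {0..}. g i j p > 0)"
    and LU: "0 < L" "L \<le> U"
    and cond2_exists: "\<forall>i\<in>{1..n}. \<forall>j\<in>{1..n}. i \<noteq> j \<longrightarrow>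
      (\<forall>\<^sub>F (x\<^sub>i, x\<^sub>j) in min_at_top. \<forall>p\<in>rv_support M (\<Theta> i) \<times> rv_support M (\<Theta> j).
        has_cond_prob M (\<lambda>\<omega>. \<bar>X i \<omega>\<bar> > x\<^sub>i \<and> X j \<omega> > x\<^sub>j) (near2 (\<Theta> i) (\<Theta> j) p) \<and>
        has_cond_prob M (\<lambda>\<omega>. X i \<omega> > x\<^sub>i \<and> X j \<omega> > x\<^sub>j) (near2 (\<Theta> i) (\<Theta> j) p))"
    and cond2_equiv: "\<forall>i\<in>{1..n}. \<forall>j\<in>{1..n}. i \<noteq> j \<longrightarrow>
      unif_asym_equiv (rv_support M (\<Theta> i) \<times> rv_support M (\<Theta> j)) min_at_top
        (\<lambda>(x\<^sub>i, x\<^sub>j) p. cond_prob_at M (\<lambda>\<omega>. \<bar>X i \<omega>\<bar> > x\<^sub>i \<and> X j \<omega> > x\<^sub>j) (near2 (\<Theta> i) (\<Theta> j) p))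
        (\<lambda>(x\<^sub>i, x\<^sub>j) p. g i j p * \<P>(\<omega> in M. \<bar>X i \<omega>\<bar> > x\<^sub>i \<and> X j \<omega> > x\<^sub>j))"
    and cond2_lower: "\<forall>i\<in>{1..n}. \<forall>j\<in>{1..n}. i \<noteq> j \<longrightarrow>
      unif_asym_le (rv_support M (\<Theta> i) \<times> rv_support M (\<Theta> j)) min_at_top
        (\<lambda>(x\<^sub>i, x\<^sub>j) p. L * g i j p * \<P>(\<omega> in M. X i \<omega> > x\<^sub>i \<and> X j \<omega> > x\<^sub>j))
        (\<lambda>(x\<^sub>i, x\<^sub>j) p. cond_prob_at M (\<lambda>\<omega>. X i \<omega> > x\<^sub>i \<and> X j \<omega> > x\<^sub>j) (near2 (\<Theta> i) (\<Theta> j) p))"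
    and cond2_upper: "\<forall>i\<in>{1..n}. \<forall>j\<in>{1..n}. i \<noteq> j \<longrightarrow>
      unif_asym_le (rv_support M (\<Theta> i) \<times> rv_support M (\<Theta> j)) min_at_top
        (\<lambda>(x\<^sub>i, x\<^sub>j) p. cond_prob_at M (\<lambda>\<omega>. X i \<omega> > x\<^sub>i \<and> X j \<omega> > x\<^sub>j) (near2 (\<Theta> i) (\<Theta> j) p))
        (\<lambda>(x\<^sub>i, x\<^sub>j) p. U * g i j p * \<P>(\<omega> in M. X i \<omega> > x\<^sub>i \<and> X j \<omega> > x\<^sub>j))"
    \<comment> \<open>the function \<open>\<phi>\<close>\<close>
    and \<phi>_nonneg: "\<forall>x. \<phi> x \<ge> 0"
    and \<phi>_mono: "\<exists>x\<^sub>0. mono_on {x\<^sub>0..} \<phi>"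
    and \<phi>_subhom: "\<exists>C>0. \<forall>\<^sub>F x in at_top. \<phi> (2 * x) \<le> C * \<phi> x"
    and \<phi>_diff: "\<forall>\<^sub>F x in at_top. \<phi> differentiable (at x)"
    and \<phi>_finite: "\<forall>i\<in>{1..n}. \<forall>\<^sub>F x in at_top.
      tail_expectation M \<phi> (\<lambda>\<omega>. \<Theta> i \<omega> * X i \<omega>) x < \<infinity>"
  shows
    "asym_le at_top
       (\<lambda>x. \<Sum>i=1..n. L_index (F i) * tail_expectation M \<phi> (\<lambda>\<omega>. \<Theta> i \<omega> * X i \<omega>) x)
       (\<lambda>x. tail_expectation M \<phi> (\<lambda>\<omega>. \<Sum>i=1..n. \<Theta> i \<omega> * X i \<omega>) x) \<and>
     asym_le at_top
       (\<lambda>x. tail_expectation M \<phi> (\<lambda>\<omega>. \<Sum>i=1..n. \<Theta> i \<omega> * X i \<omega>) x)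
       (\<lambda>x. \<Sum>i=1..n. (1 / L_index (F i)) * tail_expectation M \<phi> (\<lambda>\<omega>. \<Theta> i \<omega> * X i \<omega>) x)"
proof -
  interpret prob_space M by fact
  define T where "T i x = tail_expectation M \<phi> (\<lambda>\<omega>. \<Theta> i \<omega> * X i \<omega>) x" for i x
  define TS where "TS x = tail_expectation M \<phi> (\<lambda>\<omega>. \<Sum>i=1..n. \<Theta> i \<omega> * X i \<omega>) x" for x
  define p where "p i x = \<P>(\<omega> in M. \<Theta> i \<omega> * X i \<omega> > x)" for i x
  define pS where "pS x = \<P>(\<omega> in M. (\<Sum>i=1..n. \<Theta> i \<omega> * X i \<omega>) > x)" for x
  have W_meas: "(\<lambda>\<omega>. \<Theta> i \<omega> * X i \<omega>) \<in> borel_measurable M" if "i \<in> {1..n}" for i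
    using X_rv \<Theta>_rv that by (intro borel_measurable_times) auto
  have S_meas: "(\<lambda>\<omega>. \<Sum>i=1..n. \<Theta> i \<omega> * X i \<omega>) \<in> borel_measurable M"
    by (rule borel_measurable_sum) (rule W_meas)
  have "\<forall>i\<in>{1..n}. \<exists>l. L_index (F i) = ennreal l \<and> 0 < l"
  proof
    fix i assume i: "i \<in> {1..n}"
    have [measurable]: "X i \<in> borel_measurable M" using X_rv i by blast
    have "antimono (survival (F i))"
    proof (rule antimonoI)
      fix x y :: real assume "x \<le> y"
      then show "survival (F i) y \<le> survival (F i) x"
        using F_distribution i by (auto simp: survival_eq_prob[OF prob] intro!: finite_measure_mono)
    qed
    then show "\<exists>l. L_index (F i) = ennreal l \<and> 0 < l"
      by (rule L_index_properties[of "F i", rotated]) (use F_D F_tail_pos i in auto)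
  qed
  then obtain l where l: "\<forall>i\<in>{1..n}. L_index (F i) = ennreal (l i) \<and> 0 < l i"
    by metis
  have tails: "\<forall>\<^sub>F x in at_top. (1 - e) * (\<Sum>i=1..n. l i * p i x) \<le> pS x \<and>
      pS x \<le> (1 + e) * (\<Sum>i=1..n. (1 / l i) * p i x)" if "e > 0" for e
    unfolding p_def pS_def
    by (rule tail_of_weighted_sum[OF prob X_rv F_distribution F_tail_pos F_D X_pQAI \<Theta>_rv
          \<Theta>_nonneg \<Theta>_nondegenerate \<Theta>_tail h_pos cond1_exists cond1_equiv l that])
  obtain x0 where x0: "mono_on {x0..} \<phi>" using \<phi>_mono by blast
  obtain x1 where x1: "\<And>x. x \<ge> x1 \<Longrightarrow> \<phi> differentiable (at x)"
    using \<phi>_diff by (auto simp: eventually_at_top_linorder)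
  have \<phi>_tail: "mono_on {x<..} \<phi>" "continuous_on {x<..} \<phi>" if "x \<ge> max x0 x1" for x
  proof -
    show "mono_on {x<..} \<phi>" using x0 by (rule mono_on_subset) (use that in auto)
    show "continuous_on {x<..} \<phi>"
      using x1 that by (intro continuous_at_imp_continuous_on ballI differentiable_imp_continuous_within) auto
  qed
  have lower: "\<forall>\<^sub>F x in at_top. (\<Sum>i=1..n. L_index (F i) * T i x) \<le> ennreal c * TS x"
    if c: "c > 1" for c
  proof -
    have "1 - 1 / c > 0" using c by simp
    from tails[OF this] obtain x2 where x2: "\<And>y. y \<ge> x2 \<Longrightarrow> 1 / c * (\<Sum>i=1..n. l i * p i y) \<le> pS y"
      by (auto simp: eventually_at_top_linorder)
    show ?thesis
      using eventually_ge_at_top[of "max x0 x1"] eventually_ge_at_top[of x2]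
    proof eventually_elim
      case (elim x)
      \<comment> \<open>the sum over \<open>{()}\<close> presents the single variable on one side as a family\<close>
      have "(\<Sum>i=1..n. ennreal (l i) * tail_expectation M \<phi> (\<lambda>\<omega>. \<Theta> i \<omega> * X i \<omega>) x)
        \<le> (\<Sum>j\<in>{()}. ennreal c * tail_expectation M \<phi> (\<lambda>\<omega>. \<Sum>i=1..n. \<Theta> i \<omega> * X i \<omega>) x)"
      proof (rule tail_expectation_mono[OF prob])
        fix y assume "y \<ge> x"
        then have "1 / c * (\<Sum>i=1..n. l i * p i y) \<le> pS y" using x2 elim by simp
        then show "(\<Sum>i=1..n. l i * \<P>(\<omega> in M. \<Theta> i \<omega> * X i \<omega> > y))
            \<le> (\<Sum>j\<in>{()}. c * \<P>(\<omega> in M. (\<Sum>i=1..n. \<Theta> i \<omega> * X i \<omega>) > y))"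
          using c by (simp add: p_def pS_def pos_divide_le_eq mult.commute)
      qed (use W_meas S_meas l c \<phi>_nonneg \<phi>_tail[OF elim(1)] in \<open>auto simp: less_imp_le\<close>)
      moreover have "(\<Sum>i=1..n. L_index (F i) * T i x) = (\<Sum>i=1..n. ennreal (l i) * T i x)"
        using l by (intro sum.cong refl) auto
      ultimately show ?case by (simp add: T_def TS_def)
    qed
  qed
  have upper: "\<forall>\<^sub>F x in at_top. TS x \<le> ennreal c * (\<Sum>i=1..n. (1 / L_index (F i)) * T i x)"
    if c: "c > 1" for c
  proof -
    have "c - 1 > 0" using c by simp
    from tails[OF this] obtain x2 where x2: "\<And>y. y \<ge> x2 \<Longrightarrow> pS y \<le> c * (\<Sum>i=1..n. (1 / l i) * p i y)"
      by (auto simp: eventually_at_top_linorder)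
    have inv: "ennreal (c * (1 / l i)) = ennreal c * (1 / L_index (F i))" if "i \<in> {1..n}" for i
    proof -
      have "L_index (F i) = ennreal (l i)" "0 < l i" using l that by blast+
      then have "1 / L_index (F i) = ennreal (1 / l i)" by (simp add: divide_ennreal[symmetric])
      moreover have "ennreal (c * (1 / l i)) = ennreal c * ennreal (1 / l i)"
        using c \<open>0 < l i\<close> by (intro ennreal_mult) auto
      ultimately show ?thesis by simp
    qed
    show ?thesis
      using eventually_ge_at_top[of "max x0 x1"] eventually_ge_at_top[of x2]
    proof eventually_elim
      case (elim x)
      have "(\<Sum>j\<in>{()}. ennreal 1 * tail_expectation M \<phi> (\<lambda>\<omega>. \<Sum>i=1..n. \<Theta> i \<omega> * X i \<omega>) x)
        \<le> (\<Sum>i=1..n. ennreal (c * (1 / l i)) * tail_expectation M \<phi> (\<lambda>\<omega>. \<Theta> i \<omega> * X i \<omega>) x)"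
      proof (rule tail_expectation_mono[OF prob])
        fix y assume "y \<ge> x"
        then have "pS y \<le> c * (\<Sum>i=1..n. (1 / l i) * p i y)" using x2 elim by simp
        then show "(\<Sum>j\<in>{()}. 1 * \<P>(\<omega> in M. (\<Sum>i=1..n. \<Theta> i \<omega> * X i \<omega>) > y))
            \<le> (\<Sum>i=1..n. c * (1 / l i) * \<P>(\<omega> in M. \<Theta> i \<omega> * X i \<omega> > y))"
          by (simp add: p_def pS_def sum_distrib_left mult.assoc)
      qed (use W_meas S_meas l c \<phi>_nonneg \<phi>_tail[OF elim(1)] in \<open>auto simp: less_imp_le\<close>)
      also have "\<dots> = ennreal c * (\<Sum>i=1..n. (1 / L_index (F i)) * T i x)"
        unfolding sum_distrib_left T_def
        by (intro sum.cong refl) (simp only: inv mult.assoc)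
      finally show ?case by (simp add: TS_def)
    qed
  qed
  show ?thesis
    using asym_leI[OF lower] asym_leI[OF upper] unfolding T_def TS_def by blast
qed

end
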